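(* Let $k$ be a perfect field and let $A$ be an algebra over $k$. Suppose that there is a morphism of algebraic groups $T\to\mathrm{Aut}_k(A)$, where $T$ is a split torus over $k$. Then for every $m\in\mathbb{Z}$, $$F(A)^{\mathrm{Can}}_m=\bigoplus_{\chi}\big(A_\chi\cap F(A)^{\mathrm{Can}}_m\big),$$ where the sum is over all characters $\chi$ of $T$ and $A_\chi:=\{a\in A\mid t\cdot a=\chi(t)a\}$ is the $\chi$-weight space of $A$.
   Context: "Algebra" means a finite-dimensional, not necessarily unital, associative $k$-algebra or a finite-dimensional Lie algebra over $k$, with multiplication or bracket $\mu_A$. A filtration $F_\bullet$ of $A$ is a family of $k$-subspaces $F_m\subseteq A$, $m\in\mathbb{Z}$, such that $F_i\supseteq F_j$ when $i\le j$; $\mu_A(F_i,F_j)\subseteq F_{i+j}$ for all $i,j$; $F_i=A$ for $i\ll0$ and $F_i=0$ for $i\gg0$. The trivial filtration has $F_n=A$ for $n\le 0$ and $F_n=0$ for $n>0$. The weights of $F_\bullet$ are the integers $m$ with $F_m\ne F_{m+1}$. Set $$\mathrm{wt}(A,F_\bullet)=\sum_m m\dim(F_m/F_{m+1}),\quad \|F_\bullet\|=\Big(\sum_m m^2\dim(F_m/F_{m+1})\Big)^{1/2},\quad \nu(A,F_\bullet)=\frac{-\mathrm{wt}(A,F_\bullet)}{\|F_\bullet\|}$$ ($\nu$ for non-trivial $F_\bullet$). $A$ is semistable if $-\mathrm{wt}(A,F_\bullet)\ge0$ for all filtrations, and unstable otherwise. The canonical filtration $F(A)^{\mathrm{Can}}_\bullet$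 is the trivial filtration if $A$ is semistable, and if $A$ is unstable it is the filtration minimizing $\nu(A,-)$, which exists and is unique up to positive rescaling of the weights by a theorem of Kempf. *)

theory Defs
  imports Complex_Main "HOL-Algebra.Algebraic_Closure_Type"
begin

definition perfect_field :: "'k::field itself \<Rightarrow> bool" where
  "perfect_field _ \<longleftrightarrow>
     CHAR('k) = 0 \<or> (\<forall>x::'k. \<exists>y::'k. y ^ CHAR('k) = x)"

section \<open>Algebras, filtrations and the canonical filtration\<close>

text \<open>The basis is only a choice of coordinates; it is used for the base change to the
  algebraic closure below.\<close>

locale fd_algebra =
  finite_dimensional_vector_space scale Basis
  for scale :: "'k::field \<Rightarrow> 'a::ab_group_add \<Rightarrow> 'a"
    and Basis :: "'a set"
  + fixes \<mu> :: "'a \<Rightarrow> 'a \<Rightarrow> 'a"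
  assumes linear_left: "\<And>b. Vector_Spaces.linear scale scale (\<lambda>a. \<mu> a b)"
    and linear_right: "\<And>a. Vector_Spaces.linear scale scale (\<lambda>b. \<mu> a b)"
    and associative_or_Lie:
      "(\<forall>a b c. \<mu> (\<mu> a b) c = \<mu> a (\<mu> b c)) \<or>
       ((\<forall>a. \<mu> a a = 0) \<and>
        (\<forall>a b c. \<mu> a (\<mu> b c) + \<mu> b (\<mu> c a) + \<mu> c (\<mu> a b) = 0))"
begin

definition filtration :: "(int \<Rightarrow> 'a set) \<Rightarrow> bool" where
  "filtration F \<longleftrightarrow>
     (\<forall>m. subspace (F m)) \<and>
     (\<forall>i j. i \<le> j \<longrightarrow> F j \<subseteq> F i) \<and>
     (\<forall>i j. \<forall>a\<in>F i. \<forall>b\<in>F j. \<mu> a b \<in> F (i + j)) \<and>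
     (\<exists>N. \<forall>i\<le>N. F i = UNIV) \<and>
     (\<exists>N. \<forall>i\<ge>N. F i = {0})"

definition trivial_filtration :: "int \<Rightarrow> 'a set" where
  "trivial_filtration n = (if n \<le> 0 then UNIV else {0})"

definition weights :: "(int \<Rightarrow> 'a set) \<Rightarrow> int set" where
  "weights F = {m. F m \<noteq> F (m + 1)}"

text \<open>The dimension of the quotient \<open>F m / F (m + 1)\<close>.\<close>

definition gr_dim :: "(int \<Rightarrow> 'a set) \<Rightarrow> int \<Rightarrow> int" where
  "gr_dim F m = int (dim (F m)) - int (dim (F (m + 1)))"

text \<open>The sums over all integers reduce to the set of weights, which is finite for a
  filtration.\<close>

definition wt :: "(int \<Rightarrow> 'a set) \<Rightarrow> int" where
  "wt F = (\<Sum>m\<in>weights F. m * gr_dim F m)"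

definition filt_norm :: "(int \<Rightarrow> 'a set) \<Rightarrow> real" where
  "filt_norm F = sqrt (of_int (\<Sum>m\<in>weights F. m\<^sup>2 * gr_dim F m))"

definition \<nu> :: "(int \<Rightarrow> 'a set) \<Rightarrow> real" where
  "\<nu> F = - of_int (wt F) / filt_norm F"

definition semistable :: bool where
  "semistable \<longleftrightarrow> (\<forall>F. filtration F \<longrightarrow> - wt F \<ge> 0)"

text \<open>In the unstable case the minimizer of \<open>\<nu>\<close> is unique only up to positive rescaling of
  the weights, so being canonical is a predicate satisfied by every such minimizer.\<close>

definition canonical_filtration :: "(int \<Rightarrow> 'a set) \<Rightarrow> bool" where
  "canonical_filtration F \<longleftrightarrow>
     (if semistable then F = trivial_filtration
      else filtration F \<and> F \<noteq> trivial_filtration \<and>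
           (\<forall>G. filtration G \<and> G \<noteq> trivial_filtration \<longrightarrow> \<nu> F \<le> \<nu> G))"

end

section \<open>Split tori and their characters\<close>

text \<open>The split torus of rank \<open>r\<close> over \<open>k\<close>, as a variety: its points over the algebraic closure
  \<open>K\<close> of \<open>k\<close> are the \<open>r\<close>-tuples of units, padded with ones so that multiplication is pointwise.
  Its regular functions defined over \<open>k\<close> are the Laurent polynomials with coefficients in \<open>k\<close>.
  Tori are smooth, so morphisms of algebraic groups over \<open>k\<close> out of the torus are the
  homomorphisms on \<open>K\<close>-points that are given by regular functions defined over \<open>k\<close>.
  Points over \<open>k\<close> itself would not suffice, as \<open>k\<close> may be finite.\<close>

definition torus :: "nat \<Rightarrow> (nat \<Rightarrow> 'k::field alg_closure) set" where
  "torus r = {t. (\<forall>i<r. t i \<noteq> 0) \<and> (\<forall>i\<ge>r. t i = 1)}"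

definition torus_mult ::
    "(nat \<Rightarrow> 'k::field alg_closure) \<Rightarrow> (nat \<Rightarrow> 'k alg_closure) \<Rightarrow> nat \<Rightarrow> 'k alg_closure" where
  "torus_mult s t = (\<lambda>i. s i * t i)"

definition regular_on_torus ::
    "nat \<Rightarrow> ((nat \<Rightarrow> 'k::field alg_closure) \<Rightarrow> 'k alg_closure) \<Rightarrow> bool" where
  "regular_on_torus r f \<longleftrightarrow>
     (\<exists>(N :: (nat \<Rightarrow> int) set) (c :: (nat \<Rightarrow> int) \<Rightarrow> 'k). finite N \<and>
        (\<forall>t\<in>torus r. f t = (\<Sum>n\<in>N. to_ac (c n) * (\<Prod>i<r. t i powi n i))))"

text \<open>The characters, i.e. the morphisms to the multiplicative group. Setting them to
  \<open>undefined\<close> off the torus makes each of them occur exactly once.\<close>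

definition characters ::
    "nat \<Rightarrow> ((nat \<Rightarrow> 'k::field alg_closure) \<Rightarrow> 'k alg_closure) set" where
  "characters r =
     {\<chi>. regular_on_torus r \<chi> \<and>
         (\<forall>t\<in>torus r. \<chi> t \<noteq> 0) \<and>
         (\<forall>s\<in>torus r. \<forall>t\<in>torus r. \<chi> (torus_mult s t) = \<chi> s * \<chi> t) \<and>
         (\<forall>t. t \<notin> torus r \<longrightarrow> \<chi> t = undefined)}"

section \<open>Base change and torus actions\<close>

context fd_algebra
begin

text \<open>\<open>A \<otimes> K\<close> in coordinates, for \<open>K\<close> the algebraic closure of \<open>k\<close>: families indexed by the
  basis, with the structure constants of \<open>A\<close>; \<open>bc\<close> is the map \<open>a \<mapsto> a \<otimes> 1\<close>.\<close>

definition bc_space :: "('a \<Rightarrow> 'k alg_closure) set" where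
  "bc_space = {v. \<forall>b. b \<notin> Basis \<longrightarrow> v b = 0}"

definition bc :: "'a \<Rightarrow> 'a \<Rightarrow> 'k alg_closure" where
  "bc a = (\<lambda>b. to_ac (representation Basis a b))"

definition bc_mult ::
    "('a \<Rightarrow> 'k alg_closure) \<Rightarrow> ('a \<Rightarrow> 'k alg_closure) \<Rightarrow> 'a \<Rightarrow> 'k alg_closure" where
  "bc_mult v w = (\<lambda>c. \<Sum>a\<in>Basis. \<Sum>b\<in>Basis. v a * w b * bc (\<mu> a b) c)"

definition bc_automorphism ::
    "(('a \<Rightarrow> 'k alg_closure) \<Rightarrow> 'a \<Rightarrow> 'k alg_closure) \<Rightarrow> bool" where
  "bc_automorphism g \<longleftrightarrow>
     bij_betw g bc_space bc_space \<and>
     (\<forall>v\<in>bc_space. \<forall>w\<in>bc_space. g (\<lambda>b. v b + w b) = (\<lambda>b. g v b + g w b)) \<and>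
     (\<forall>x. \<forall>v\<in>bc_space. g (\<lambda>b. x * v b) = (\<lambda>b. x * g v b)) \<and>
     (\<forall>v\<in>bc_space. \<forall>w\<in>bc_space. g (bc_mult v w) = bc_mult (g v) (g w))"

text \<open>A morphism of algebraic groups over \<open>k\<close> from the torus to the automorphism group of \<open>A\<close>:
  the matrix entries in the chosen basis are regular functions defined over \<open>k\<close>.\<close>

definition torus_action ::
    "nat \<Rightarrow> ((nat \<Rightarrow> 'k alg_closure) \<Rightarrow> ('a \<Rightarrow> 'k alg_closure) \<Rightarrow> 'a \<Rightarrow> 'k alg_closure)
      \<Rightarrow> bool" where
  "torus_action r \<rho> \<longleftrightarrow>
     (\<forall>t\<in>torus r. bc_automorphism (\<rho> t)) \<and>
     (\<forall>s\<in>torus r. \<forall>t\<in>torus r. \<forall>v\<in>bc_space. \<rho> (torus_mult s t) v = \<rho> s (\<rho> t v)) \<and>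
     (\<forall>b\<in>Basis. \<forall>c\<in>Basis. regular_on_torus r (\<lambda>t. \<rho> t (bc b) c))"

definition weight_space ::
    "nat \<Rightarrow> ((nat \<Rightarrow> 'k alg_closure) \<Rightarrow> ('a \<Rightarrow> 'k alg_closure) \<Rightarrow> 'a \<Rightarrow> 'k alg_closure)
      \<Rightarrow> ((nat \<Rightarrow> 'k alg_closure) \<Rightarrow> 'k alg_closure) \<Rightarrow> 'a set" where
  "weight_space r \<rho> \<chi> = {a. \<forall>t\<in>torus r. \<rho> t (bc a) = (\<lambda>b. \<chi> t * bc a b)}"

end

section \<open>Internal direct sums\<close>

text \<open>\<open>W\<close> is the internal direct sum of the \<open>U i\<close>: summation is a bijection onto \<open>W\<close> from the
  finitely supported families.\<close>

definition internal_direct_sum :: "'i set \<Rightarrow> ('i \<Rightarrow> 'a::ab_group_add set) \<Rightarrow> 'a set \<Rightarrow> bool" where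
  "internal_direct_sum I U W \<longleftrightarrow>
     bij_betw (\<lambda>f. \<Sum>i | f i \<noteq> 0. f i)
       {f. (\<forall>i\<in>I. f i \<in> U i) \<and> (\<forall>i. i \<notin> I \<longrightarrow> f i = 0) \<and> finite {i. f i \<noteq> 0}} W"

end

theory Submission
  imports Defs
begin

text \<open>
  A split torus action is the same as a grading of \<open>A\<close> by characters, so the claim is that the
  canonical filtration \<open>F\<close> is homogeneous for this grading. The proof degenerates \<open>F\<close> to a
  homogeneous filtration with the same numerical invariants and shows that the degeneration
  does not change \<open>F\<close>.

  Finitely many characters of the torus are separated by a one-parameter subgroup, which turns the
  weight decomposition into a grading of \<open>A\<close> by integers (\<open>separating_cocharacter\<close>). For such a
  grading the spans of the lowest-degree components of the elements of the \<open>F m\<close> form a filtration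
  again, the limit of \<open>F\<close> under the one-parameter subgroup
  (\<open>filtration_initial_filtration\<close>). Its graded pieces have the same dimensions as those of \<open>F\<close>,
  hence it has the same weight, norm and \<open>\<nu>\<close> (\<open>initial_filtration_wt_norm\<close>).

  In the semistable case \<open>F\<close> is trivial, hence homogeneous. It remains to see that in the unstable case a minimizer of \<open>\<nu>\<close> is determined by its weight and
  norm (\<open>canonical_filtration_unique\<close>), which is the convexity behind Kempf's theorem. Two
  filtrations \<open>F\<close> and \<open>G\<close> have a common adapted basis (\<open>common_adapted_basis\<close>). Adding the weights
  that they give to its members yields a third filtration, because it is also the family of the
  subspaces \<open>\<Sum>\<^bsub>i+j\<ge>m\<^esub> F i \<inter> G j\<close>. Its weight is the sum of the weights of \<open>F\<close> and \<open>G\<close>,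
  and by the triangle inequality its norm is at most the sum of the norms; minimality of \<open>\<nu> F < 0\<close>
  forces equality, and then the two weight vectors agree.

  Finally, that \<open>A\<close> is the direct sum of its weight spaces follows by expanding the matrix entries
  of the action into Laurent monomials and comparing coefficients, the monomials being linearly
  independent functions on the torus (\<open>monomials_independent\<close>).
\<close>

section \<open>Laurent monomials and characters of the torus\<close>

text \<open>In a finite field, the product of all linear factors \<open>x - a\<close> increased by one has no roots.\<close>

lemma alg_closed_field_infinite: "infinite (UNIV :: 'a::alg_closed_field set)"
proof
  assume fin: "finite (UNIV :: 'a set)"
  define p :: "'a poly" where "p = (\<Prod>a\<in>UNIV. [:-a, 1:])"
  have "poly p x = 0" for x
    unfolding p_def poly_prod by (rule prod_zero[OF fin]) (auto intro: bexI[of _ x])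
  then have root: "poly (p + 1) x \<noteq> 0" for x by simp
  have "Polynomial.degree p = card (UNIV :: 'a set)"
    unfolding p_def by (subst degree_prod_sum_eq) auto
  then have "Polynomial.degree (p + 1) > 0"
    using fin by (subst degree_add_eq_left) (auto simp: card_gt_0_iff)
  then show False using alg_closed_imp_poly_has_root root by blast
qed

text \<open>Only the first \<open>r\<close> entries of an exponent vector affect the monomial; setting the others to zero
  makes the exponent vector of a monomial unique.\<close>

definition exponents :: "nat \<Rightarrow> (nat \<Rightarrow> int) set" where
  "exponents r = {n. \<forall>i\<ge>r. n i = 0}"

definition monomial :: "nat \<Rightarrow> (nat \<Rightarrow> int) \<Rightarrow> (nat \<Rightarrow> 'k::field alg_closure) \<Rightarrow> 'k alg_closure" where
  "monomial r n t = (\<Prod>i<r. t i powi n i)"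

text \<open>Two distinct exponent vectors have the same pairing with \<open>(1, x, x\<^sup>2, \<dots>)\<close> only if \<open>x\<close> is a root of
  a nonzero polynomial. Hence all but finitely many integers \<open>x\<close> give a one-parameter subgroup
  that separates the vectors in \<open>N\<close>.\<close>

lemma separating_cocharacter:
  fixes N :: "(nat \<Rightarrow> int) set"
  assumes fin: "finite N" and N: "N \<subseteq> exponents r"
  obtains l :: "nat \<Rightarrow> int" where "inj_on (\<lambda>n. \<Sum>i<r. l i * n i) N"
proof -
  define q :: "(nat \<Rightarrow> int) \<Rightarrow> (nat \<Rightarrow> int) \<Rightarrow> int poly" where
    "q n n' = (\<Sum>i<r. Polynomial.monom (n i - n' i) i)" for n n'
  have "q n n' \<noteq> 0" if "n \<in> N" "n' \<in> N" "n \<noteq> n'" for n n'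
  proof
    assume "q n n' = 0"
    have "n j = n' j" if "j < r" for j
    proof -
      have "Polynomial.coeff (q n n') j = (\<Sum>i<r. if i = j then n i - n' i else 0)"
        unfolding q_def coeff_sum by (intro sum.cong) auto
      then show ?thesis using \<open>q n n' = 0\<close> that by simp
    qed
    moreover have "n j = n' j" if "\<not> j < r" for j
    proof -
      have "n \<in> exponents r" "n' \<in> exponents r" using N \<open>n \<in> N\<close> \<open>n' \<in> N\<close> by blast+
      then show ?thesis using that unfolding exponents_def by simp
    qed
    ultimately show False using \<open>n \<noteq> n'\<close> by blast
  qed
  then have "finite (\<Union>n\<in>N. \<Union>n'\<in>N - {n}. {x. poly (q n n') x = 0})"
    using fin by (intro finite_UN_I) (auto intro!: poly_roots_finite)
  then obtain x where x: "x \<notin> (\<Union>n\<in>N. \<Union>n'\<in>N - {n}. {x. poly (q n n') x = 0})"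
    using ex_new_if_finite[OF infinite_UNIV_int] by blast
  have "inj_on (\<lambda>n. \<Sum>i<r. x ^ i * n i) N"
  proof (rule inj_onI, rule ccontr)
    fix n n' assume n: "n \<in> N" "n' \<in> N" "n \<noteq> n'" and eq: "(\<Sum>i<r. x ^ i * n i) = (\<Sum>i<r. x ^ i * n' i)"
    have "poly (q n n') x = (\<Sum>i<r. x ^ i * n i) - (\<Sum>i<r. x ^ i * n' i)"
      unfolding q_def poly_sum by (simp add: poly_monom algebra_simps sum_subtractf)
    then show False using x n eq by auto
  qed
  then show ?thesis by (rule that)
qed

lemma powi_sum: "x \<noteq> 0 \<Longrightarrow> x powi (\<Sum>i\<in>I. f i) = (\<Prod>i\<in>I. x powi f i)" for x :: "'a::field"
  by (induction I rule: infinite_finite_induct) (simp_all add: power_int_add)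

text \<open>Restricting to a one-parameter subgroup that separates the exponents gives a Laurent polynomial in
  one variable with the same coefficients, which vanishes at infinitely many points.\<close>

lemma monomials_independent:
  fixes c :: "(nat \<Rightarrow> int) \<Rightarrow> 'k::field alg_closure"
  assumes fin: "finite N" and N: "N \<subseteq> exponents r"
    and zero: "\<And>t. t \<in> torus r \<Longrightarrow> (\<Sum>n\<in>N. monomial r n t * c n) = 0"
    and n: "n \<in> N"
  shows "c n = 0"
proof -
  obtain l :: "nat \<Rightarrow> int" where "inj_on (\<lambda>n. \<Sum>i<r. l i * n i) N"
    using separating_cocharacter[OF fin N] .
  then obtain d where d: "d = (\<lambda>n. \<Sum>i<r. l i * n i)" and inj: "inj_on d N" by blast
  \<comment> \<open>Multiplying by the power \<open>M\<close> of the variable clears negative exponents.\<close>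
  obtain M :: nat where M: "\<And>n. n \<in> N \<Longrightarrow> 0 \<le> d n + int M"
  proof
    fix n assume "n \<in> N"
    then have "Min (insert 0 (d ` N)) \<le> d n" using fin by simp
    then show "0 \<le> d n + int (nat (- Min (insert 0 (d ` N))))" by linarith
  qed
  define p where "p = (\<Sum>n\<in>N. Polynomial.monom (c n) (nat (d n + int M)))"
  have "poly p x = 0" if x: "x \<noteq> 0" for x
  proof -
    define t where "t = (\<lambda>i. if i < r then x powi l i else 1)"
    have "t \<in> torus r" unfolding torus_def t_def using x by simp
    moreover have "monomial r n t = x powi d n" for n
      unfolding monomial_def t_def d powi_sum[OF x] by (intro prod.cong) (simp_all add: power_int_mult)
    ultimately have "(\<Sum>n\<in>N. x powi d n * c n) = 0" using zero[of t] by simp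
    moreover have "poly p x = x ^ M * (\<Sum>n\<in>N. x powi d n * c n)"
      unfolding p_def poly_sum sum_distrib_left
    proof (intro sum.cong refl)
      fix n assume "n \<in> N"
      then have "x ^ nat (d n + int M) = x powi (d n + int M)"
        using M by (metis power_int_of_nat nat_0_le)
      then show "poly (Polynomial.monom (c n) (nat (d n + int M))) x = x ^ M * (x powi d n * c n)"
        using x by (simp add: poly_monom power_int_add)
    qed
    ultimately show ?thesis by simp
  qed
  then have "UNIV - {0} \<subseteq> {x. poly p x = 0}" by blast
  moreover have "infinite (UNIV - {0 :: 'k alg_closure})" using alg_closed_field_infinite by simp
  ultimately have "p = 0" using poly_roots_finite finite_subset by blast
  then have "Polynomial.coeff p (nat (d n + int M)) = 0" by simp
  moreover have "Polynomial.coeff p (nat (d n + int M)) = (\<Sum>n'\<in>N. if n' = n then c n' else 0)"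
    unfolding p_def coeff_sum
  proof (intro sum.cong refl)
    fix n' assume n': "n' \<in> N"
    have "nat (d n' + int M) = nat (d n + int M) \<longleftrightarrow> n' = n"
      using M[OF n] M[OF n'] inj_on_eq_iff[OF inj n' n] by auto
    then show "Polynomial.coeff (Polynomial.monom (c n') (nat (d n' + int M))) (nat (d n + int M))
        = (if n' = n then c n' else 0)" by simp
  qed
  ultimately show ?thesis using fin n by (simp add: sum.delta)
qed

lemma monomials_independent_eq:
  assumes "finite N" "N \<subseteq> exponents r"
    and "\<And>t. t \<in> torus r \<Longrightarrow> (\<Sum>n\<in>N. monomial r n t * c n) = (\<Sum>n\<in>N. monomial r n t * c' n)"
    and "n \<in> N"
  shows "c n = c' n"
  using monomials_independent[OF assms(1,2) _ assms(4), of "\<lambda>n. c n - c' n"] assms(3)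
  by (simp add: algebra_simps sum_subtractf)

lemma monomial_inject:
  assumes n: "n \<in> exponents r" "n' \<in> exponents r"
    and eq: "\<And>t :: nat \<Rightarrow> 'k::field alg_closure. t \<in> torus r \<Longrightarrow> monomial r n t = monomial r n' t"
  shows "n = n'"
proof (rule ccontr)
  assume ne: "n \<noteq> n'"
  have "(if n = n then 1 else - 1 :: 'k alg_closure) = 0"
    by (rule monomials_independent[of "{n, n'}" r "\<lambda>k. if k = n then 1 else - 1"])
      (use ne n eq in auto)
  then show False by simp
qed

lemma one_in_torus: "(\<lambda>i. 1) \<in> torus r"
  and torus_mult_in_torus: "s \<in> torus r \<Longrightarrow> t \<in> torus r \<Longrightarrow> torus_mult s t \<in> torus r"
  unfolding torus_def torus_mult_def by simp_all

lemma monomial_one: "monomial r n (\<lambda>i. 1) = 1"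
  unfolding monomial_def by simp

lemma monomial_torus_mult: "monomial r n (torus_mult s t) = monomial r n s * monomial r n t"
  unfolding monomial_def torus_mult_def by (simp add: power_int_mult_distrib prod.distrib)

lemma monomial_add:
  "t \<in> torus r \<Longrightarrow> monomial r (\<lambda>i. n i + n' i) t = monomial r n t * monomial r n' t"
  unfolding monomial_def torus_def by (simp add: power_int_add prod.distrib)

lemma monomial_nonzero: "t \<in> torus r \<Longrightarrow> monomial r n t \<noteq> 0"
  unfolding monomial_def torus_def by simp

lemma regular_on_torus_exponents:
  assumes "regular_on_torus r f"
  shows "\<exists>N c. finite N \<and> N \<subseteq> exponents r \<and>
    (\<forall>t\<in>torus r. f t = (\<Sum>n\<in>N. to_ac (c n) * monomial r n t))"
proof -
  obtain N c where N: "finite N"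
    and f: "\<And>t. t \<in> torus r \<Longrightarrow> f t = (\<Sum>n\<in>N. to_ac (c n) * monomial r n t)"
    using assms unfolding regular_on_torus_def monomial_def by blast
  define cut :: "(nat \<Rightarrow> int) \<Rightarrow> nat \<Rightarrow> int" where "cut n i = (if i < r then n i else 0)" for n i
  have mon: "monomial r (cut n) t = monomial r n t" for n and t :: "nat \<Rightarrow> 'a alg_closure"
    unfolding monomial_def cut_def by (intro prod.cong) auto
  have "f t = (\<Sum>n\<in>cut ` N. to_ac (\<Sum>n'\<in>{n' \<in> N. cut n' = n}. c n') * monomial r n t)"
    if "t \<in> torus r" for t
  proof -
    have "f t = (\<Sum>n\<in>cut ` N. \<Sum>n'\<in>{n' \<in> N. cut n' = n}. to_ac (c n') * monomial r n' t)"
      unfolding f[OF that] by (rule sum.image_gen[OF N])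
    also have "\<dots> = (\<Sum>n\<in>cut ` N. to_ac (\<Sum>n'\<in>{n' \<in> N. cut n' = n}. c n') * monomial r n t)"
      unfolding to_ac_sum sum_distrib_right by (intro sum.cong) (auto simp: mon)
    finally show ?thesis .
  qed
  moreover have "cut ` N \<subseteq> exponents r" unfolding exponents_def cut_def by auto
  moreover have "finite (cut ` N)" using N by simp
  ultimately show ?thesis by (intro exI[of _ "cut ` N"] exI conjI ballI)
qed

text \<open>The value \<open>undefined\<close> off the torus is the one that the members of \<open>characters r\<close> take there.\<close>

definition monomial_character ::
    "nat \<Rightarrow> (nat \<Rightarrow> int) \<Rightarrow> (nat \<Rightarrow> 'k::field alg_closure) \<Rightarrow> 'k alg_closure" where
  "monomial_character r n t = (if t \<in> torus r then monomial r n t else undefined)"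

lemma inj_on_monomial_character:
  "inj_on (monomial_character r :: _ \<Rightarrow> (nat \<Rightarrow> 'k::field alg_closure) \<Rightarrow> 'k alg_closure)
     (exponents r)"
proof (rule inj_onI)
  fix n n'
  assume n: "n \<in> exponents r" "n' \<in> exponents r"
    and eq: "(monomial_character r n :: (nat \<Rightarrow> 'k alg_closure) \<Rightarrow> 'k alg_closure) =
      monomial_character r n'"
  have "monomial r n t = monomial r n' t" if "t \<in> torus r" for t :: "nat \<Rightarrow> 'k alg_closure"
    using fun_cong[OF eq, of t] that by (simp add: monomial_character_def)
  then show "n = n'" by (rule monomial_inject[OF n])
qed

lemma monomial_character_in_characters: "monomial_character r n \<in> characters r"
proof -
  have "regular_on_torus r (monomial_character r n)"
    unfolding regular_on_torus_def
    by (intro exI[of _ "{n}"] exI[of _ "\<lambda>_. 1"]) (simp add: monomial_character_def monomial_def)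
  then show ?thesis
    unfolding characters_def
    by (simp add: monomial_character_def torus_mult_in_torus monomial_torus_mult monomial_nonzero)
qed

context fd_algebra
begin

interpretation endo: vector_space_pair scale scale ..

section \<open>Flags and adapted bases\<close>

text \<open>Adapted bases and weights only depend on the underlying flag of subspaces. Flags that are not known to
  be multiplicative occur as well, namely the one defined by a grading.\<close>

definition flag :: "(int \<Rightarrow> 'a set) \<Rightarrow> bool" where
  "flag F \<longleftrightarrow> (\<forall>m. subspace (F m)) \<and> (\<forall>i j. i \<le> j \<longrightarrow> F j \<subseteq> F i) \<and>
     (\<exists>N. \<forall>i\<le>N. F i = UNIV) \<and> (\<exists>N. \<forall>i\<ge>N. F i = {0})"

lemma filtration_iff_flag:
  "filtration F \<longleftrightarrow> flag F \<and> (\<forall>i j. \<forall>a\<in>F i. \<forall>b\<in>F j. \<mu> a b \<in> F (i + j))"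
  unfolding filtration_def flag_def by (rule iffI; elim conjE; intro conjI; assumption)

lemma filtration_flag: "filtration F \<Longrightarrow> flag F"
  by (simp add: filtration_iff_flag)

lemma flag_subspace: "flag F \<Longrightarrow> subspace (F m)"
  and flag_antimono: "flag F \<Longrightarrow> i \<le> j \<Longrightarrow> F j \<subseteq> F i"
  unfolding flag_def by simp_all

lemma flag_exhaustive:
  assumes "flag F" obtains N where "\<And>i. i \<le> N \<Longrightarrow> F i = UNIV"
  using assms unfolding flag_def by blast

lemma flag_separated:
  assumes "flag F" obtains M where "\<And>i. M \<le> i \<Longrightarrow> F i = {0}"
  using assms unfolding flag_def by blast

text \<open>The largest \<open>m\<close> with \<open>b \<in> F m\<close>; it is meaningful for \<open>b \<noteq> 0\<close> only, since \<open>0\<close> lies in every \<open>F m\<close>.\<close>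

definition level :: "(int \<Rightarrow> 'a set) \<Rightarrow> 'a \<Rightarrow> int" where
  "level F b = (SOME l. \<forall>m. b \<in> F m \<longleftrightarrow> m \<le> l)"

lemma mem_flag_iff_le_level:
  assumes F: "flag F" and b: "b \<noteq> 0"
  shows "b \<in> F m \<longleftrightarrow> m \<le> level F b"
proof -
  obtain N M where N: "\<forall>i\<le>N. F i = UNIV" and M: "\<forall>i\<ge>M. F i = {0}"
    using F unfolding flag_def by blast
  define S where "S = {m \<in> {N..M}. b \<in> F m}"
  have NM: "N \<le> M" using N M b by (metis UNIV_I linorder_linear singletonD order_refl)
  have fin: "finite S" unfolding S_def by (rule finite_subset[of _ "{N..M}"]) auto
  have ne: "S \<noteq> {}" using N NM by (auto simp: S_def)
  have "b \<in> F m \<longleftrightarrow> m \<le> Max S" for m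
  proof
    assume bm: "b \<in> F m"
    have "m < M" using M bm b by (metis linorder_not_le singletonD)
    show "m \<le> Max S"
    proof (cases "N \<le> m")
      case True
      then have "m \<in> S" using bm \<open>m < M\<close> by (simp add: S_def)
      then show ?thesis using fin by simp
    next
      case False
      have "Max S \<in> S" using fin ne by (rule Max_in)
      then show ?thesis using False by (simp add: S_def)
    qed
  next
    assume "m \<le> Max S"
    moreover have "Max S \<in> S" using fin ne by (rule Max_in)
    ultimately show "b \<in> F m"
      using flag_antimono[OF F, of m "Max S"] by (auto simp: S_def)
  qed
  then have "\<exists>l. \<forall>m. b \<in> F m \<longleftrightarrow> m \<le> l" by blast
  then have "\<forall>m. b \<in> F m \<longleftrightarrow> m \<le> level F b"
    unfolding level_def by (rule someI_ex)
  then show ?thesis by blast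
qed

definition adapted_basis :: "'a set \<Rightarrow> (int \<Rightarrow> 'a set) \<Rightarrow> bool" where
  "adapted_basis B F \<longleftrightarrow> independent B \<and> span B = UNIV \<and> (\<forall>m. F m = span (B \<inter> F m))"

lemma
  assumes "adapted_basis B F"
  shows adapted_basis_independent: "independent B"
    and span_adapted_basis_Int: "span (B \<inter> F m) = F m"
proof -
  have B: "independent B \<and> span B = UNIV \<and> (\<forall>m. F m = span (B \<inter> F m))"
    using assms unfolding adapted_basis_def .
  show "independent B" using B by (rule conjunct1)
  have "F m = span (B \<inter> F m)" using B by (elim conjE) (rule spec)
  then show "span (B \<inter> F m) = F m" by (rule sym)
qed

lemma independent_nonzero: "independent B \<Longrightarrow> b \<in> B \<Longrightarrow> b \<noteq> 0"
  using dependent_zero by blast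

lemma independent_mem_span_subset:
  assumes "independent B" "C \<subseteq> B" "b \<in> B" "b \<in> span C"
  shows "b \<in> C"
proof (rule ccontr)
  assume "b \<notin> C"
  then have "span C \<subseteq> span (B - {b})" using assms(2) by (intro span_mono) blast
  then show False using assms unfolding dependent_def by blast
qed

lemma adapted_basis_level_set:
  assumes "flag F" "adapted_basis B F"
  shows "B \<inter> F m = {b \<in> B. m \<le> level F b}"
proof -
  have "b \<in> F m \<longleftrightarrow> m \<le> level F b" if "b \<in> B" for b
    by (rule mem_flag_iff_le_level[OF assms(1)
      independent_nonzero[OF adapted_basis_independent[OF assms(2)] that]])
  then show ?thesis by auto
qed

text \<open>The number of members of an adapted basis of level \<open>m\<close> is the dimension of \<open>F m / F (m + 1)\<close>. So weight
  and squared norm become the sum and the sum of squares of the levels of the basis members.\<close>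

lemma sum_weights_eq_sum_level:
  assumes F: "flag F" and B: "adapted_basis B F"
  shows "(\<Sum>m\<in>weights F. \<phi> m * gr_dim F m) = (\<Sum>b\<in>B. \<phi> (level F b))"
proof -
  have ind: "independent B" using B by (rule adapted_basis_independent)
  have fin: "finite B" using ind by (rule finiteI_independent)
  have dimF: "dim (F m) = card {b \<in> B. m \<le> level F b}" for m
  proof -
    have "dim (F m) = dim (span (B \<inter> F m))" by (simp only: span_adapted_basis_Int[OF B])
    also have "\<dots> = card (B \<inter> F m)"
      by (rule dim_span_eq_card_independent) (rule independent_mono[OF ind], blast)
    finally show ?thesis using adapted_basis_level_set[OF F B] by simp
  qed
  have gr: "gr_dim F m = int (card {b \<in> B. level F b = m})" for m
  proof -
    have "{b \<in> B. m \<le> level F b} = {b \<in> B. m + 1 \<le> level F b} \<union> {b \<in> B. level F b = m}"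
      by auto
    moreover have "card ({b \<in> B. m + 1 \<le> level F b} \<union> {b \<in> B. level F b = m})
        = card {b \<in> B. m + 1 \<le> level F b} + card {b \<in> B. level F b = m}"
      by (rule card_Un_disjoint) (use fin in auto)
    ultimately show ?thesis by (simp add: gr_dim_def dimF)
  qed
  have w: "weights F = level F ` B"
  proof (intro equalityI subsetI)
    fix m assume "m \<in> weights F"
    then have "span (B \<inter> F m) \<noteq> span (B \<inter> F (m + 1))"
      unfolding weights_def span_adapted_basis_Int[OF B] by simp
    then have "B \<inter> F m \<noteq> B \<inter> F (m + 1)" by auto
    then obtain b where "b \<in> B" "m \<le> level F b" "\<not> m + 1 \<le> level F b"
      unfolding adapted_basis_level_set[OF F B] by auto
    then show "m \<in> level F ` B" by force
  next
    fix m assume "m \<in> level F ` B"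
    then obtain b where b: "b \<in> B" "level F b = m" by blast
    then have "b \<in> F m" "b \<notin> F (m + 1)"
      using mem_flag_iff_le_level[OF F independent_nonzero[OF ind b(1)]] by simp_all
    then show "m \<in> weights F" unfolding weights_def by blast
  qed
  have "(\<Sum>b\<in>B. \<phi> (level F b)) = (\<Sum>m\<in>level F ` B. \<Sum>b\<in>{b \<in> B. level F b = m}. \<phi> (level F b))"
    by (rule sum.image_gen[OF fin])
  also have "\<dots> = (\<Sum>m\<in>weights F. \<phi> m * gr_dim F m)"
    unfolding w by (intro sum.cong) (simp_all add: gr mult.commute)
  finally show ?thesis by simp
qed

lemma wt_eq_sum_level:
  assumes "flag F" "adapted_basis B F"
  shows "wt F = (\<Sum>b\<in>B. level F b)"
  using sum_weights_eq_sum_level[OF assms, of "\<lambda>m. m"] by (simp add: wt_def)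

lemma filt_norm_eq_sum_level:
  assumes "flag F" "adapted_basis B F"
  shows "filt_norm F = sqrt (of_int (\<Sum>b\<in>B. (level F b)\<^sup>2))"
  using sum_weights_eq_sum_level[OF assms, of "\<lambda>m. m\<^sup>2"] by (simp add: filt_norm_def)

text \<open>A maximal independent set that is adapted to \<open>G\<close> spans \<open>W\<close>: otherwise a vector of maximal \<open>G\<close>-level in
  the complement of its span can be added. Such a vector does not spoil adaptedness, since no other vector
  outside the span has a larger level.\<close>

lemma extend_adapted_independent_set:
  assumes G: "flag G" and W: "subspace W"
    and B: "independent B" "B \<subseteq> W" "\<And>j. span B \<inter> G j \<subseteq> span (B \<inter> G j)"
  shows "\<exists>C. B \<subseteq> C \<and> independent C \<and> span C = W \<and> (\<forall>j. W \<inter> G j \<subseteq> span (C \<inter> G j))"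
proof -
  define Q where "Q C \<longleftrightarrow> B \<subseteq> C \<and> C \<subseteq> W \<and> independent C \<and>
     (\<forall>j. span C \<inter> G j \<subseteq> span (C \<inter> G j))" for C
  have "Q B" using B by (simp add: Q_def)
  moreover have "\<forall>C. Q C \<longrightarrow> card C < Suc (dim W)"
    using independent_card_le_dim unfolding Q_def by (simp add: less_Suc_eq_le)
  ultimately obtain C where QC: "Q C" and max: "\<And>C'. Q C' \<Longrightarrow> card C' \<le> card C"
    using ex_has_greatest_nat[of Q B card "Suc (dim W)"] by auto
  have C: "B \<subseteq> C" "C \<subseteq> W" "independent C" "\<And>j. span C \<inter> G j \<subseteq> span (C \<inter> G j)"
    using QC unfolding Q_def by blast+
  have "span C = W"
  proof (rule ccontr)
    assume "span C \<noteq> W"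
    moreover have "span C \<subseteq> W" using C(2) W by (rule span_minimal)
    ultimately have ne: "W - span C \<noteq> {}" by blast
    obtain M where M: "\<forall>i\<ge>M. G i = {0}" using G unfolding flag_def by blast
    have bd: "level G y \<le> M" if "y \<in> W - span C" for y
    proof -
      have "y \<noteq> 0" using that span_zero by blast
      then show ?thesis
        using mem_flag_iff_le_level[OF G, of y "level G y"] M
        by (metis linorder_linear order_refl singletonD)
    qed
    obtain x where x: "x \<in> W - span C"
      and xmax: "\<And>y. y \<in> W - span C \<Longrightarrow> level G y \<le> level G x"
    proof -
      obtain x0 where x0: "x0 \<in> W - span C" using ne by blast
      have "\<exists>x. x \<in> W - span C \<and> (\<forall>y. y \<in> W - span C \<longrightarrow> nat (M - level G x) \<le> nat (M - level G y))"
        by (rule ex_has_least_nat[of "\<lambda>y. y \<in> W - span C", OF x0])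
      then obtain x where x: "x \<in> W - span C"
        "\<forall>y. y \<in> W - span C \<longrightarrow> nat (M - level G x) \<le> nat (M - level G y)" by blast
      have "level G y \<le> level G x" if "y \<in> W - span C" for y
        using x(2)[rule_format, OF that] bd[OF that] bd[OF x(1)] by linarith
      then show ?thesis using that x(1) by blast
    qed
    have x0: "x \<noteq> 0" using x span_zero by blast
    have "span (insert x C) \<inter> G j \<subseteq> span (insert x C \<inter> G j)" for j
    proof
      fix y assume y: "y \<in> span (insert x C) \<inter> G j"
      then obtain k where k: "y - scale k x \<in> span C"
        using span_breakdown_eq by blast
      show "y \<in> span (insert x C \<inter> G j)"
      proof (cases "y \<in> span C")
        case True
        then have "y \<in> span (C \<inter> G j)" using C(4) y by blast
        then show ?thesis using span_mono[of "C \<inter> G j" "insert x C \<inter> G j"] by blast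
      next
        case False
        have "span (insert x C) \<subseteq> W"
          by (rule span_minimal) (use x C(2) W in auto)
        then have "y \<in> W - span C" using y False by blast
        then have le: "level G y \<le> level G x" by (rule xmax)
        have "y \<noteq> 0" using False span_zero by blast
        then have "x \<in> G j"
          using y le mem_flag_iff_le_level[OF G] x0 by force
        then have "y - scale k x \<in> G j"
          using y flag_subspace[OF G] by (simp add: subspace_diff subspace_scale)
        then have "y - scale k x \<in> span (C \<inter> G j)" using k C(4) by blast
        then have "y \<in> span (insert x (C \<inter> G j))" using span_breakdown_eq by blast
        moreover have "insert x (C \<inter> G j) = insert x C \<inter> G j" using \<open>x \<in> G j\<close> by blast
        ultimately show ?thesis by simp
      qed
    qed
    then have "Q (insert x C)"
      using C(1,2) x independent_insertI[OF _ C(3), of x] unfolding Q_def by blast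
    then have "card (insert x C) \<le> card C" by (rule max)
    moreover have "x \<notin> C" using x span_base by blast
    ultimately show False using finiteI_independent[OF C(3)] by simp
  qed
  then show ?thesis using C by auto
qed

text \<open>This is the fact that two flags lie in a common apartment. The basis is built along \<open>F\<close>, starting from the
  zero subspace: a basis of \<open>F i\<close> adapted to \<open>G\<close> is extended to one of the next larger step
  \<open>F (i - 1)\<close>.\<close>

lemma common_adapted_basis:
  assumes F: "flag F" and G: "flag G"
  shows "\<exists>B. independent B \<and> span B = UNIV \<and> (\<forall>i j. F i \<inter> G j \<subseteq> span (B \<inter> F i \<inter> G j))"
proof -
  obtain N M where N: "\<forall>i\<le>N. F i = UNIV" and M: "\<forall>i\<ge>M. F i = {0}"
    using F unfolding flag_def by blast
  define P where "P i \<longleftrightarrow> (\<exists>B. independent B \<and> span B = F i \<and>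
      (\<forall>i'\<ge>i. \<forall>j. F i' \<inter> G j \<subseteq> span (B \<inter> F i' \<inter> G j)))" for i
  have "P M"
    unfolding P_def by (rule exI[of _ "{}"]) (use M in \<open>auto simp: independent_empty span_zero\<close>)
  moreover have "P (i - 1)" if Pi: "P i" for i
  proof -
    obtain B where B: "independent B" "span B = F i"
      "\<And>i' j. i \<le> i' \<Longrightarrow> F i' \<inter> G j \<subseteq> span (B \<inter> F i' \<inter> G j)"
      using Pi unfolding P_def by blast
    have BF: "B \<subseteq> F i" using B(2) span_superset by blast
    have "F i \<subseteq> F (i - 1)" using flag_antimono[OF F] by simp
    moreover have "span B \<inter> G j \<subseteq> span (B \<inter> G j)" for j
      using B(3)[of i j] B(2) BF by (simp add: Int_absorb2)
    ultimately have "\<exists>C. B \<subseteq> C \<and> independent C \<and> span C = F (i - 1) \<and>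
        (\<forall>j. F (i - 1) \<inter> G j \<subseteq> span (C \<inter> G j))"
      using BF by (intro extend_adapted_independent_set[OF G flag_subspace[OF F] B(1)]) auto
    then obtain C where C: "B \<subseteq> C" "independent C" "span C = F (i - 1)"
      "\<And>j. F (i - 1) \<inter> G j \<subseteq> span (C \<inter> G j)" by metis
    have "F i' \<inter> G j \<subseteq> span (C \<inter> F i' \<inter> G j)" if "i - 1 \<le> i'" for i' j
    proof (cases "i \<le> i'")
      case True
      have "span (B \<inter> F i' \<inter> G j) \<subseteq> span (C \<inter> F i' \<inter> G j)"
        by (rule span_mono) (use C(1) in blast)
      then show ?thesis using B(3)[OF True] by blast
    next
      case False
      then have "i' = i - 1" using that by simp
      moreover have "C \<inter> F (i - 1) = C" using C(3) span_superset by blast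
      ultimately show ?thesis using C(4) by simp
    qed
    then show ?thesis unfolding P_def using C by blast
  qed
  ultimately have "P (min N M)"
    by (intro int_le_induct[of "min N M" M P]) auto
  then obtain B where B: "independent B" "span B = F (min N M)"
    "\<And>i j. min N M \<le> i \<Longrightarrow> F i \<inter> G j \<subseteq> span (B \<inter> F i \<inter> G j)"
    unfolding P_def by blast
  have U: "F i = UNIV" if "i \<le> min N M" for i using N that by simp
  have "F i \<inter> G j \<subseteq> span (B \<inter> F i \<inter> G j)" for i j
  proof (cases "min N M \<le> i")
    case False
    then have "i \<le> min N M" by linarith
    then have "F i = F (min N M)" using U[of i] U[of "min N M"] by simp
    then show ?thesis using B(3)[of "min N M" j] by simp
  qed (rule B(3))
  then show ?thesis using B(1,2) U[of "min N M"] by auto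
qed

lemma adapted_basisI:
  assumes "flag F" "independent B" "span B = UNIV" "\<And>m. F m \<subseteq> span (B \<inter> F m)"
  shows "adapted_basis B F"
proof -
  have "span (B \<inter> F m) \<subseteq> F m" for m
    by (rule span_minimal) (use flag_subspace[OF assms(1)] in auto)
  then show ?thesis unfolding adapted_basis_def using assms by (intro conjI allI equalityI) auto
qed

lemma common_adapted_basis_adapted:
  assumes F: "flag F" and G: "flag G" and B: "independent B" "span B = UNIV"
    "\<And>i j. F i \<inter> G j \<subseteq> span (B \<inter> F i \<inter> G j)"
  shows "adapted_basis B F" "adapted_basis B G"
proof -
  obtain N where N: "F N = UNIV" using F unfolding flag_def by blast
  obtain M where M: "G M = UNIV" using G unfolding flag_def by blast
  show "adapted_basis B F"
    by (rule adapted_basisI[OF F B(1,2)]) (use B(3)[of _ M] M in simp)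
  show "adapted_basis B G"
    by (rule adapted_basisI[OF G B(1,2)]) (use B(3)[of N] N in simp)
qed

text \<open>In terms of a common adapted basis of \<open>F\<close> and \<open>G\<close> this is the filtration for which the level of each
  member is the sum of its two levels. The description without a basis shows that the construction respects
  multiplication.\<close>

definition filtration_sum :: "(int \<Rightarrow> 'a set) \<Rightarrow> (int \<Rightarrow> 'a set) \<Rightarrow> int \<Rightarrow> 'a set" where
  "filtration_sum F G m = span (\<Union>i j. if m \<le> i + j then F i \<inter> G j else {})"

lemma filtration_sum_base: "x \<in> F i \<Longrightarrow> x \<in> G j \<Longrightarrow> m \<le> i + j \<Longrightarrow> x \<in> filtration_sum F G m"
  unfolding filtration_sum_def by (rule span_base) force

lemma bilinear_span_closed:
  assumes x: "x \<in> span U" and y: "y \<in> span V" and T: "subspace T"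
    and UV: "\<And>a b. a \<in> U \<Longrightarrow> b \<in> V \<Longrightarrow> \<mu> a b \<in> T"
  shows "\<mu> x y \<in> T"
proof -
  have 1: "\<mu> a y \<in> T" if "a \<in> U" for a
    using y
  proof (induction rule: span_induct)
    case base show ?case
      using endo.linear_subspace_vimage[OF linear_right T] by (simp add: vimage_def)
  qed (use UV that in auto)
  show ?thesis
    using x
  proof (induction rule: span_induct)
    case base show ?case
      using endo.linear_subspace_vimage[OF linear_left T, of y] by (simp add: vimage_def)
  qed (use 1 in auto)
qed

lemma filtration_filtration_sum:
  assumes F: "filtration F" and G: "filtration G"
  shows "filtration (filtration_sum F G)"
proof -
  let ?H = "filtration_sum F G"
  have fF: "flag F" and fG: "flag G" using F G by (simp_all add: filtration_flag)
  obtain N where N: "\<And>i. i \<le> N \<Longrightarrow> F i = UNIV" using flag_exhaustive[OF fF] by blast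
  obtain N' where N': "\<And>i. i \<le> N' \<Longrightarrow> G i = UNIV" using flag_exhaustive[OF fG] by blast
  obtain M where M: "\<And>i. M \<le> i \<Longrightarrow> F i = {0}" using flag_separated[OF fF] by blast
  obtain M' where M': "\<And>i. M' \<le> i \<Longrightarrow> G i = {0}" using flag_separated[OF fG] by blast
  have sub: "subspace (?H m)" for m unfolding filtration_sum_def by simp
  have mono: "?H j \<subseteq> ?H i" if "i \<le> j" for i j
    unfolding filtration_sum_def by (rule span_mono) (use that in \<open>force split: if_splits\<close>)
  have mult: "\<mu> x y \<in> ?H (i + j)" if "x \<in> ?H i" "y \<in> ?H j" for i j x y
  proof (rule bilinear_span_closed[OF that[unfolded filtration_sum_def] sub])
    fix a b
    assume "a \<in> (\<Union>p q. if i \<le> p + q then F p \<inter> G q else {})"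
      and "b \<in> (\<Union>p q. if j \<le> p + q then F p \<inter> G q else {})"
    then obtain p q p' q' where
      "a \<in> F p" "a \<in> G q" "i \<le> p + q" "b \<in> F p'" "b \<in> G q'" "j \<le> p' + q'"
      by (auto split: if_splits)
    moreover from this have "\<mu> a b \<in> F (p + p')" "\<mu> a b \<in> G (q + q')"
      using F G unfolding filtration_def by blast+
    ultimately show "\<mu> a b \<in> ?H (i + j)" by (auto intro: filtration_sum_base)
  qed
  have low: "?H m = UNIV" if "m \<le> N + N'" for m
    using filtration_sum_base[of _ F N G N' m] N[of N] N'[of N'] that by auto
  have high: "?H m = {0}" if "M + M' \<le> m" for m
  proof -
    have "F i \<inter> G j \<subseteq> {0}" if "m \<le> i + j" for i j
    proof (cases "M \<le> i")
      case False
      then have "M' \<le> j" using that \<open>M + M' \<le> m\<close> by linarith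
      then show ?thesis using M' by blast
    qed (use M in blast)
    then have "?H m \<subseteq> {0}"
      unfolding filtration_sum_def by (intro span_minimal) (auto split: if_splits)
    then show ?thesis using subspace_0[OF sub] by blast
  qed
  have "\<exists>N. \<forall>m\<le>N. ?H m = UNIV" "\<exists>N. \<forall>m\<ge>N. ?H m = {0}"
    using low high by blast+
  then show ?thesis
    unfolding filtration_def using sub mono mult by (intro conjI) auto
qed

text \<open>The span of the basis members with sum of levels at least \<open>m\<close> lies in \<open>filtration_sum F G m\<close> and contains every
  \<open>F i \<inter> G j\<close> with \<open>i + j \<ge> m\<close>.\<close>

lemma level_filtration_sum:
  assumes F: "filtration F" and G: "filtration G" and B: "independent B" "span B = UNIV"
    "\<And>i j. F i \<inter> G j \<subseteq> span (B \<inter> F i \<inter> G j)"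
  shows "adapted_basis B (filtration_sum F G)"
    and "b \<in> B \<Longrightarrow> level (filtration_sum F G) b = level F b + level G b"
proof -
  let ?H = "filtration_sum F G"
  let ?L = "\<lambda>m. {b \<in> B. m \<le> level F b + level G b}"
  have fF: "flag F" and fG: "flag G" and fH: "flag ?H"
    using F G filtration_filtration_sum[OF F G] by (simp_all add: filtration_flag)
  note lev = mem_flag_iff_le_level[OF _ independent_nonzero[OF B(1)]]
  have "F i \<inter> G j \<subseteq> span (?L m)" if "m \<le> i + j" for i j m
  proof -
    have "B \<inter> F i \<inter> G j \<subseteq> ?L m"
    proof
      fix b assume b: "b \<in> B \<inter> F i \<inter> G j"
      then have "i \<le> level F b" "j \<le> level G b" using lev[OF fF, of b] lev[OF fG, of b] by auto
      then show "b \<in> ?L m" using b that by simp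
    qed
    then have "span (B \<inter> F i \<inter> G j) \<subseteq> span (?L m)" by (rule span_mono)
    then show ?thesis using B(3)[of i j] by (rule subset_trans[rotated])
  qed
  then have 1: "?H m \<subseteq> span (?L m)" for m
    unfolding filtration_sum_def by (intro span_minimal) (auto split: if_splits)
  have 2: "?L m \<subseteq> ?H m" for m
  proof
    fix b assume b: "b \<in> ?L m"
    then have "b \<in> F (level F b)" "b \<in> G (level G b)" using lev[OF fF, of b] lev[OF fG, of b] by auto
    then show "b \<in> ?H m" by (rule filtration_sum_base) (use b in simp)
  qed
  show "adapted_basis B ?H"
  proof (rule adapted_basisI[OF fH B(1,2)])
    fix m
    have "?L m \<subseteq> B \<inter> ?H m" using 2[of m] by blast
    then have "span (?L m) \<subseteq> span (B \<inter> ?H m)" by (rule span_mono)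
    then show "?H m \<subseteq> span (B \<inter> ?H m)" using 1[of m] by blast
  qed
  show "level ?H b = level F b + level G b" if b: "b \<in> B"
  proof -
    have "m \<le> level ?H b \<longleftrightarrow> m \<le> level F b + level G b" for m
    proof
      assume "m \<le> level ?H b"
      then have "b \<in> span (?L m)" using 1[of m] lev[OF fH b] by blast
      then have "b \<in> ?L m" by (rule independent_mem_span_subset[OF B(1) _ b, rotated]) blast
      then show "m \<le> level F b + level G b" by simp
    next
      assume "m \<le> level F b + level G b"
      then have "b \<in> ?H m" using 2[of m] b by blast
      then show "m \<le> level ?H b" using lev[OF fH b] by blast
    qed
    from this[of "level ?H b"] this[of "level F b + level G b"] show ?thesis by simp
  qed
qed

lemma flag_adapted_basis:
  assumes "flag F"
  obtains B where "adapted_basis B F"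
proof -
  obtain B where B: "independent B" "span B = UNIV"
    "\<And>i j. F i \<inter> F j \<subseteq> span (B \<inter> F i \<inter> F j)"
    using common_adapted_basis[OF assms assms] by metis
  show ?thesis by (rule that, rule common_adapted_basis_adapted(1)[OF assms assms B])
qed

lemma adapted_basis_finite: "adapted_basis B F \<Longrightarrow> finite B"
  using finiteI_independent adapted_basis_independent by blast

lemma filt_norm_pos:
  assumes F: "flag F" and wt: "wt F \<noteq> 0"
  shows "filt_norm F > 0"
proof -
  obtain B where B: "adapted_basis B F" using F by (rule flag_adapted_basis)
  obtain b where b: "b \<in> B" "level F b \<noteq> 0"
    using wt unfolding wt_eq_sum_level[OF F B] by (meson sum.neutral)
  have "(\<Sum>b\<in>B. (level F b)\<^sup>2) > 0"
    by (rule sum_pos2[OF adapted_basis_finite[OF B] b(1)]) (use b(2) in auto)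
  then show ?thesis unfolding filt_norm_eq_sum_level[OF F B] by (simp del: of_int_sum)
qed

lemma wt_trivial_filtration: "wt trivial_filtration = 0"
proof -
  have "weights trivial_filtration \<subseteq> {0}"
    unfolding weights_def trivial_filtration_def by auto
  then show ?thesis unfolding wt_def by (intro sum.neutral) auto
qed

lemma canonical_wt_pos:
  assumes "\<not> semistable" and F: "canonical_filtration F"
  shows "wt F > 0"
proof -
  obtain G where G: "filtration G" "wt G > 0"
    using assms(1) unfolding semistable_def by force
  have "G \<noteq> trivial_filtration" using G wt_trivial_filtration by force
  then have le: "\<nu> F \<le> \<nu> G" using assms G(1) unfolding canonical_filtration_def by simp
  have "filt_norm G > 0" using G by (simp add: filt_norm_pos filtration_flag)
  then have "\<nu> G < 0" using G(2) unfolding \<nu>_def by (simp add: divide_neg_pos)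
  then have "\<nu> F < 0" using le by simp
  moreover have "filt_norm F \<ge> 0"
  proof -
    have "flag F" using F assms(1) filtration_flag unfolding canonical_filtration_def by simp
    then obtain B where B: "adapted_basis B F" using flag_adapted_basis by blast
    show ?thesis unfolding filt_norm_eq_sum_level[OF \<open>flag F\<close> B] by (simp add: sum_nonneg)
  qed
  ultimately show ?thesis
    unfolding \<nu>_def by (simp add: zero_less_divide_iff)
qed

text \<open>Let \<open>f\<close> and \<open>g\<close> be the levels of \<open>F\<close> and \<open>G\<close> on a common adapted basis. The sum filtration has weight
  \<open>2 * wt F > 0\<close>, so minimality of \<open>\<nu> F\<close> makes its norm at least twice that of \<open>F\<close>, that is
  \<open>\<Sum>(f + g)\<^sup>2 \<ge> 4 \<Sum>f\<^sup>2 = 2 \<Sum>f\<^sup>2 + 2 \<Sum>g\<^sup>2\<close>. By the parallelogram identity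
  \<open>\<Sum>(f - g)\<^sup>2 \<le> 0\<close>.\<close>

lemma canonical_filtration_unique:
  assumes unst: "\<not> semistable" and F: "canonical_filtration F" and G: "filtration G"
    and wtG: "wt G = wt F" and nG: "filt_norm G = filt_norm F"
  shows "G = F"
proof -
  have fil: "filtration F" using F unst unfolding canonical_filtration_def by simp
  have fF: "flag F" and fG: "flag G" using fil G by (simp_all add: filtration_flag)
  obtain B where B: "independent B" "span B = UNIV"
    "\<And>i j. F i \<inter> G j \<subseteq> span (B \<inter> F i \<inter> G j)"
    using common_adapted_basis[OF fF fG] by metis
  let ?H = "filtration_sum F G"
  let ?f = "level F" let ?g = "level G"
  have fin: "finite B" using B(1) by (rule finiteI_independent)
  have BF: "adapted_basis B F" and BG: "adapted_basis B G"
    by (fact common_adapted_basis_adapted[OF fF fG B])+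
  have H: "filtration ?H" and BH: "adapted_basis B ?H"
    and lH: "\<And>b. b \<in> B \<Longrightarrow> level ?H b = ?f b + ?g b"
    by (fact filtration_filtration_sum[OF fil G] level_filtration_sum[OF fil G B])+
  have fH: "flag ?H" using H by (rule filtration_flag)
  have wpos: "wt F > 0" using unst F by (rule canonical_wt_pos)
  have wH: "wt ?H = 2 * wt F"
    using wtG lH unfolding wt_eq_sum_level[OF fF BF] wt_eq_sum_level[OF fG BG]
      wt_eq_sum_level[OF fH BH] by (simp add: sum.distrib)
  have "?H \<noteq> trivial_filtration" using wH wpos wt_trivial_filtration by force
  then have "\<nu> F \<le> \<nu> ?H" using F unst H unfolding canonical_filtration_def by simp
  moreover have pF: "filt_norm F > 0" and pH: "filt_norm ?H > 0"
    using filt_norm_pos fF fH wH wpos by auto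
  ultimately have "2 * filt_norm F \<le> filt_norm ?H"
    using wpos unfolding \<nu>_def wH by (simp add: field_simps)
  then have "(2 * filt_norm F)\<^sup>2 \<le> (filt_norm ?H)\<^sup>2"
    using pF by (intro power_mono) auto
  then have "4 * (\<Sum>b\<in>B. (?f b)\<^sup>2) \<le> (\<Sum>b\<in>B. (level ?H b)\<^sup>2)"
    unfolding filt_norm_eq_sum_level[OF fF BF] filt_norm_eq_sum_level[OF fH BH]
    by (simp add: power_mult_distrib sum_nonneg flip: of_int_power of_int_sum)
  moreover have "(\<Sum>b\<in>B. (?g b)\<^sup>2) = (\<Sum>b\<in>B. (?f b)\<^sup>2)"
    using nG unfolding filt_norm_eq_sum_level[OF fF BF] filt_norm_eq_sum_level[OF fG BG] by (simp del: of_int_sum)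
  moreover have "(\<Sum>b\<in>B. (level ?H b)\<^sup>2) + (\<Sum>b\<in>B. (?f b - ?g b)\<^sup>2)
      = 2 * (\<Sum>b\<in>B. (?f b)\<^sup>2) + 2 * (\<Sum>b\<in>B. (?g b)\<^sup>2)"
    unfolding sum_distrib_left sum.distrib[symmetric]
    by (intro sum.cong) (simp_all add: lH power2_eq_square algebra_simps)
  ultimately have "(\<Sum>b\<in>B. (?f b - ?g b)\<^sup>2) \<le> 0" by linarith
  then have "(\<Sum>b\<in>B. (?f b - ?g b)\<^sup>2) = 0" by (simp add: order_antisym sum_nonneg)
  then have fg: "?f b = ?g b" if "b \<in> B" for b
    using sum_nonneg_eq_0_iff[OF fin, of "\<lambda>b. (?f b - ?g b)\<^sup>2"] that by simp
  have "B \<inter> G m = B \<inter> F m" for m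
    unfolding adapted_basis_level_set[OF fF BF] adapted_basis_level_set[OF fG BG] using fg by auto
  then have "span (B \<inter> G m) = span (B \<inter> F m)" for m by simp
  moreover have "span (B \<inter> G m) = G m" "span (B \<inter> F m) = F m" for m
    by (fact span_adapted_basis_Int[OF BG] span_adapted_basis_Int[OF BF])+
  ultimately show "G = F" by (intro ext) simp
qed

section \<open>The initial filtration with respect to a grading\<close>

text \<open>A grading is given by its projections \<open>\<pi> d\<close>, with \<open>S\<close> a finite set containing all degrees that occur.\<close>

definition grading :: "int set \<Rightarrow> (int \<Rightarrow> 'a \<Rightarrow> 'a) \<Rightarrow> bool" where
  "grading S \<pi> \<longleftrightarrow> finite S \<and>
     (\<forall>d. Vector_Spaces.linear scale scale (\<pi> d)) \<and>
     (\<forall>d e x. \<pi> d (\<pi> e x) = (if d = e then \<pi> e x else 0)) \<and>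
     (\<forall>x. (\<Sum>d\<in>S. \<pi> d x) = x) \<and>
     (\<forall>d e x y. \<pi> (d + e) (\<mu> (\<pi> d x) (\<pi> e y)) = \<mu> (\<pi> d x) (\<pi> e y))"

definition grading_flag :: "(int \<Rightarrow> 'a \<Rightarrow> 'a) \<Rightarrow> int \<Rightarrow> 'a set" where
  "grading_flag \<pi> d = {x. \<forall>e<d. \<pi> e x = 0}"

text \<open>The span of the lowest-degree components of the elements of \<open>F m\<close>; geometrically, the limit at \<open>0\<close> of the
  translates of \<open>F m\<close> under the one-parameter group acting on degree \<open>d\<close> by the
  \<open>d\<close>-th power.\<close>

definition initial_filtration :: "(int \<Rightarrow> 'a \<Rightarrow> 'a) \<Rightarrow> (int \<Rightarrow> 'a set) \<Rightarrow> int \<Rightarrow> 'a set" where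
  "initial_filtration \<pi> F m = span (\<Union>d. \<pi> d ` (F m \<inter> grading_flag \<pi> d))"

context
  fixes S :: "int set" and \<pi> :: "int \<Rightarrow> 'a \<Rightarrow> 'a"
  assumes grading: "grading S \<pi>"
begin

lemma grading_finite: "finite S"
  and grading_linear: "Vector_Spaces.linear scale scale (\<pi> d)"
  and grading_proj: "\<pi> d (\<pi> e x) = (if d = e then \<pi> e x else 0)"
  and grading_sum: "(\<Sum>d\<in>S. \<pi> d x) = x"
  and grading_mult: "\<pi> (d + e) (\<mu> (\<pi> d x) (\<pi> e y)) = \<mu> (\<pi> d x) (\<pi> e y)"
  using grading unfolding grading_def by simp_all

lemma grading_mult_component:
  "\<pi> c (\<mu> (\<pi> d x) (\<pi> e y)) = (if c = d + e then \<mu> (\<pi> d x) (\<pi> e y) else 0)"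
  using grading_proj[of c "d + e" "\<mu> (\<pi> d x) (\<pi> e y)"] by (simp add: grading_mult)

lemma grading_outside: "d \<notin> S \<Longrightarrow> \<pi> d x = 0"
proof -
  assume "d \<notin> S"
  have "\<pi> d x = \<pi> d (\<Sum>e\<in>S. \<pi> e x)" by (simp add: grading_sum)
  also have "\<dots> = (\<Sum>e\<in>S. \<pi> d (\<pi> e x))" by (rule endo.linear_sum[OF grading_linear])
  also have "\<dots> = 0" using \<open>d \<notin> S\<close> by (intro sum.neutral) (auto simp: grading_proj)
  finally show ?thesis .
qed

lemma mult_component:
  "\<pi> c (\<mu> x y) = (\<Sum>d\<in>S. \<Sum>e\<in>S. if c = d + e then \<mu> (\<pi> d x) (\<pi> e y) else 0)"
proof -
  have "\<mu> x y = \<mu> (\<Sum>d\<in>S. \<pi> d x) (\<Sum>e\<in>S. \<pi> e y)" by (simp add: grading_sum)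
  also have "\<dots> = (\<Sum>d\<in>S. \<mu> (\<pi> d x) (\<Sum>e\<in>S. \<pi> e y))"
    by (rule endo.linear_sum[OF linear_left])
  also have "\<dots> = (\<Sum>d\<in>S. \<Sum>e\<in>S. \<mu> (\<pi> d x) (\<pi> e y))"
    by (intro sum.cong refl endo.linear_sum[OF linear_right])
  finally have "\<mu> x y = (\<Sum>d\<in>S. \<Sum>e\<in>S. \<mu> (\<pi> d x) (\<pi> e y))" .
  then show ?thesis
    by (simp only: endo.linear_sum[OF grading_linear] grading_mult_component)
qed

lemma flag_grading_flag: "flag (grading_flag \<pi>)"
proof -
  have sub: "subspace (grading_flag \<pi> d)" for d
    unfolding grading_flag_def subspace_def
    by (simp add: endo.linear_0[OF grading_linear] endo.linear_add[OF grading_linear]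
        endo.linear_scale[OF grading_linear])
  have mono: "grading_flag \<pi> e \<subseteq> grading_flag \<pi> d" if "d \<le> e" for d e
    unfolding grading_flag_def using that by auto
  obtain N M where "\<And>d. d \<in> S \<Longrightarrow> N \<le> d" "\<And>d. d \<in> S \<Longrightarrow> d < M"
  proof
    show "Min (insert 0 S) \<le> d" if "d \<in> S" for d using that grading_finite by simp
    show "d < Max (insert 0 S) + 1" if "d \<in> S" for d using that grading_finite by simp
  qed
  note NM = this
  have low: "grading_flag \<pi> d = UNIV" if "d \<le> N" for d
    unfolding grading_flag_def using NM(1) that grading_outside by force
  have high: "grading_flag \<pi> d = {0}" if "M \<le> d" for d
  proof -
    have "x = 0" if "x \<in> grading_flag \<pi> d" for x
    proof -
      have "(\<Sum>e\<in>S. \<pi> e x) = 0"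
        using that NM(2) \<open>M \<le> d\<close> unfolding grading_flag_def by (intro sum.neutral) force
      then show ?thesis by (simp add: grading_sum)
    qed
    then show ?thesis using subspace_0[OF sub] by blast
  qed
  show ?thesis
    unfolding flag_def using sub mono low high by (intro conjI) auto
qed

text \<open>Multiplicativity holds because the component of \<open>\<mu> x y\<close> in the sum of the lowest degrees of \<open>x\<close> and
  \<open>y\<close> is the product of their lowest components, and all components of smaller degree vanish.\<close>

lemma filtration_initial_filtration:
  assumes F: "filtration F"
  shows "filtration (initial_filtration \<pi> F)"
proof -
  let ?G = "initial_filtration \<pi> F"
  have fF: "flag F" using F by (rule filtration_flag)
  have sub: "subspace (?G m)" for m unfolding initial_filtration_def by simp
  have mono: "?G j \<subseteq> ?G i" if "i \<le> j" for i j
    unfolding initial_filtration_def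
    by (rule span_mono) (use flag_antimono[OF fF that] in blast)
  have mult: "\<mu> x y \<in> ?G (i + j)" if "x \<in> ?G i" "y \<in> ?G j" for i j x y
  proof (rule bilinear_span_closed[OF that[unfolded initial_filtration_def] sub])
    fix a b
    assume "a \<in> (\<Union>d. \<pi> d ` (F i \<inter> grading_flag \<pi> d))"
      and "b \<in> (\<Union>d. \<pi> d ` (F j \<inter> grading_flag \<pi> d))"
    then obtain d e x y where a: "a = \<pi> d x" "x \<in> F i" "x \<in> grading_flag \<pi> d"
      and b: "b = \<pi> e y" "y \<in> F j" "y \<in> grading_flag \<pi> e" by blast
    have lead: "(if c = d' + e' then \<mu> (\<pi> d' x) (\<pi> e' y) else 0) = 0"
      if "c \<le> d + e" "(c, d') \<noteq> (d + e, d)" for c d' e'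
    proof (cases "c = d' + e'")
      case True
      then have "d' < d \<or> e' < e" using that by auto
      then have "\<pi> d' x = 0 \<or> \<pi> e' y = 0" using a(3) b(3) unfolding grading_flag_def by blast
      then show ?thesis
        using endo.linear_0[OF linear_left] endo.linear_0[OF linear_right] by auto
    qed simp
    have "\<mu> x y \<in> F (i + j)" using F a(2) b(2) unfolding filtration_def by simp
    moreover have "\<mu> x y \<in> grading_flag \<pi> (d + e)"
      unfolding grading_flag_def
    proof (intro CollectI allI impI)
      fix c assume "c < d + e"
      then show "\<pi> c (\<mu> x y) = 0"
        unfolding mult_component by (intro sum.neutral ballI lead) auto
    qed
    moreover have "\<pi> (d + e) (\<mu> x y) = \<mu> a b"
    proof -
      have "\<pi> (d + e) (\<mu> x y) =
          (\<Sum>d'\<in>S. \<Sum>e'\<in>S. if d' = d \<and> e' = e then \<mu> (\<pi> d x) (\<pi> e y) else 0)"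
        unfolding mult_component
      proof (intro sum.cong refl)
        fix d' e'
        show "(if d + e = d' + e' then \<mu> (\<pi> d' x) (\<pi> e' y) else 0) =
            (if d' = d \<and> e' = e then \<mu> (\<pi> d x) (\<pi> e y) else 0)"
          using lead[of "d + e" d' e'] by (cases "d' = d") auto
      qed
      also have "\<dots> = (\<Sum>d'\<in>S. if d' = d then (\<Sum>e'\<in>S. if e' = e then \<mu> (\<pi> d x) (\<pi> e y) else 0) else 0)"
        by (intro sum.cong) auto
      also have "\<dots> = (if d \<in> S then if e \<in> S then \<mu> (\<pi> d x) (\<pi> e y) else 0 else 0)"
        using grading_finite by (simp add: sum.delta)
      also have "\<dots> = \<mu> a b"
        unfolding a(1) b(1)
        using grading_outside endo.linear_0[OF linear_left] endo.linear_0[OF linear_right] by auto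
      finally show ?thesis .
    qed
    ultimately show "\<mu> a b \<in> ?G (i + j)"
      unfolding initial_filtration_def by (intro span_base) (metis (lifting) IntI UN_I UNIV_I imageI)
  qed
  obtain N where N: "\<And>i. i \<le> N \<Longrightarrow> F i = UNIV" using flag_exhaustive[OF fF] by blast
  obtain M where M: "\<And>i. M \<le> i \<Longrightarrow> F i = {0}" using flag_separated[OF fF] by blast
  have low: "?G m = UNIV" if "m \<le> N" for m
  proof -
    have "\<pi> d x \<in> ?G m" for d x
      unfolding initial_filtration_def
    proof (intro span_base UN_I UNIV_I)
      have "\<pi> d x \<in> F m \<inter> grading_flag \<pi> d"
        using N[OF that] by (simp add: grading_flag_def grading_proj)
      then have "\<pi> d (\<pi> d x) \<in> \<pi> d ` (F m \<inter> grading_flag \<pi> d)" by (rule imageI)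
      then show "\<pi> d x \<in> \<pi> d ` (F m \<inter> grading_flag \<pi> d)" by (simp add: grading_proj)
    qed
    then have "(\<Sum>d\<in>S. \<pi> d x) \<in> ?G m" for x by (intro subspace_sum sub)
    then show ?thesis unfolding grading_sum by blast
  qed
  have high: "?G m = {0}" if "M \<le> m" for m
  proof -
    have "?G m \<subseteq> {0}"
      unfolding initial_filtration_def
      by (intro span_minimal) (auto simp: M[OF that] endo.linear_0[OF grading_linear])
    then show ?thesis using subspace_0[OF sub] by blast
  qed
  have "\<exists>N. \<forall>m\<le>N. ?G m = UNIV" "\<exists>N. \<forall>m\<ge>N. ?G m = {0}"
    using low high by blast+
  then show ?thesis
    unfolding filtration_def using sub mono mult by (intro conjI) auto
qed

text \<open>Take a common adapted basis \<open>B\<close> of \<open>F\<close> and the degree flag. The lowest components of the members of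
  \<open>B \<inter> F m\<close> span the initial filtration in step \<open>m\<close>, because an element of
  \<open>F m\<close> without components below degree \<open>d\<close> is a combination of members with the same property,
  and \<open>\<pi> d\<close> kills those whose lowest degree is larger. For small \<open>m\<close> this gives a spanning set of \<open>A\<close>, of
  at most \<open>dim A\<close> elements, so the lowest components are a basis, and their levels are those of \<open>B\<close>.\<close>

lemma initial_filtration_wt_norm:
  assumes F: "filtration F"
  shows "wt (initial_filtration \<pi> F) = wt F"
    and "filt_norm (initial_filtration \<pi> F) = filt_norm F"
proof -
  let ?G = "initial_filtration \<pi> F" and ?D = "grading_flag \<pi>"
  have fF: "flag F" and fG: "flag ?G" and fD: "flag ?D"
    using F filtration_initial_filtration[OF F] flag_grading_flag by (simp_all add: filtration_flag)
  obtain B where B: "independent B" "span B = UNIV"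
    "\<And>i j. F i \<inter> ?D j \<subseteq> span (B \<inter> F i \<inter> ?D j)"
    using common_adapted_basis[OF fF fD] by metis
  have BF: "adapted_basis B F" by (rule common_adapted_basis_adapted(1)[OF fF fD B])
  have finB: "finite B" using B(1) by (rule finiteI_independent)
  define ini where "ini b = \<pi> (level ?D b) b" for b
  have memD: "b \<in> ?D d \<longleftrightarrow> d \<le> level ?D b" if "b \<in> B" for b d
    by (rule mem_flag_iff_le_level[OF fD independent_nonzero[OF B(1) that]])
  have G: "?G m = span (ini ` (B \<inter> F m))" for m
  proof (rule antisym)
    have "\<pi> d x \<in> span (ini ` (B \<inter> F m))" if x: "x \<in> F m \<inter> ?D d" for d x
    proof -
      have "\<pi> d x \<in> \<pi> d ` span (B \<inter> F m \<inter> ?D d)" using B(3)[of m d] x by blast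
      also have "\<dots> = span (\<pi> d ` (B \<inter> F m \<inter> ?D d))"
        by (rule endo.linear_span_image[OF grading_linear, symmetric])
      also have "\<dots> \<subseteq> span (ini ` (B \<inter> F m))"
      proof (intro span_minimal subspace_span image_subsetI)
        fix b assume b: "b \<in> B \<inter> F m \<inter> ?D d"
        show "\<pi> d b \<in> span (ini ` (B \<inter> F m))"
        proof (cases "level ?D b = d")
          case True
          then have "\<pi> d b = ini b" by (simp add: ini_def)
          then show ?thesis using b by (auto intro: span_base)
        next
          case False
          then have "b \<in> ?D (d + 1)" using b memD[of b d] memD[of b "d + 1"] by auto
          then have "\<pi> d b = 0" unfolding grading_flag_def by simp
          then show ?thesis by (simp add: span_zero)
        qed
      qed
      finally show ?thesis .
    qed
    then show "?G m \<subseteq> span (ini ` (B \<inter> F m))"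
      unfolding initial_filtration_def by (intro span_minimal subspace_span) blast
    show "span (ini ` (B \<inter> F m)) \<subseteq> ?G m"
      unfolding initial_filtration_def
    proof (rule span_mono, rule image_subsetI)
      fix b assume b: "b \<in> B \<inter> F m"
      then have "b \<in> F m \<inter> ?D (level ?D b)" using memD by auto
      then show "ini b \<in> (\<Union>d. \<pi> d ` (F m \<inter> ?D d))" unfolding ini_def by blast
    qed
  qed
  have spini: "span (ini ` B) = UNIV"
  proof -
    obtain N where "\<And>i. i \<le> N \<Longrightarrow> F i = UNIV" using flag_exhaustive[OF fF] by blast
    moreover obtain N' where "\<And>i. i \<le> N' \<Longrightarrow> ?G i = UNIV" using flag_exhaustive[OF fG] by blast
    ultimately show ?thesis using G[of "min N N'"] by simp
  qed
  have cardB: "card B = dim (UNIV :: 'a set)" using dim_eq_card[of B UNIV] B(1,2) by simp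
  have inj: "inj_on ini B"
  proof (rule eq_card_imp_inj_on[OF finB])
    have "dim (UNIV :: 'a set) \<le> card (ini ` B)"
      using dim_le_card[of UNIV "ini ` B"] spini finB by simp
    then show "card (ini ` B) = card B" using card_image_le[OF finB, of ini] cardB by simp
  qed
  have ind: "independent (ini ` B)"
    by (rule card_le_dim_spanning[of _ UNIV]) (use spini finB cardB card_image_le[OF finB, of ini] in simp_all)
  have lev: "ini b \<in> ?G m \<longleftrightarrow> b \<in> F m" if b: "b \<in> B" for b m
  proof
    assume "ini b \<in> ?G m"
    then have "ini b \<in> ini ` (B \<inter> F m)"
      unfolding G by (rule independent_mem_span_subset[OF ind _ imageI[OF b], rotated]) blast
    then show "b \<in> F m" using inj b by (auto dest: inj_onD)
  qed (use b in \<open>auto simp: G intro: span_base\<close>)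
  have BG: "adapted_basis (ini ` B) ?G"
  proof (rule adapted_basisI[OF fG ind spini])
    fix m
    have "ini ` (B \<inter> F m) \<subseteq> ini ` B \<inter> ?G m" using lev by auto
    then show "?G m \<subseteq> span (ini ` B \<inter> ?G m)" unfolding G[of m] by (intro span_mono)
  qed
  have level: "level ?G (ini b) = level F b" if b: "b \<in> B" for b
  proof -
    have "m \<le> level ?G (ini b) \<longleftrightarrow> m \<le> level F b" for m
      using lev[OF b, of m] mem_flag_iff_le_level[OF fF independent_nonzero[OF B(1) b]]
        mem_flag_iff_le_level[OF fG independent_nonzero[OF ind imageI[OF b]]] by simp
    from this[of "level ?G (ini b)"] this[of "level F b"] show ?thesis by simp
  qed
  have sums: "(\<Sum>b\<in>ini ` B. \<phi> (level ?G b)) = (\<Sum>b\<in>B. \<phi> (level F b))" for \<phi> :: "int \<Rightarrow> int"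
    by (simp add: sum.reindex[OF inj] level)
  show "wt ?G = wt F"
    unfolding wt_eq_sum_level[OF fG BG] wt_eq_sum_level[OF fF BF] using sums[of "\<lambda>m. m"] .
  show "filt_norm ?G = filt_norm F"
    unfolding filt_norm_eq_sum_level[OF fG BG] filt_norm_eq_sum_level[OF fF BF]
    using sums[of "\<lambda>m. m\<^sup>2"] by (simp only:)
qed

text \<open>In the unstable case \<open>F\<close> equals its initial filtration, whose steps are spanned by homogeneous elements.\<close>

theorem canonical_filtration_graded:
  assumes F: "canonical_filtration F" and x: "x \<in> F m"
  shows "\<pi> d x \<in> F m"
proof (cases semistable)
  case True
  then have "F = trivial_filtration" using F unfolding canonical_filtration_def by simp
  then show ?thesis
    using x endo.linear_0[OF grading_linear]
    unfolding trivial_filtration_def by (auto split: if_splits)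
next
  case False
  then have fil: "filtration F" using F unfolding canonical_filtration_def by simp
  have eq: "initial_filtration \<pi> F = F"
    by (rule canonical_filtration_unique[OF False F filtration_initial_filtration[OF fil]
        initial_filtration_wt_norm[OF fil]])
  let ?U = "\<Union>e. \<pi> e ` (F m \<inter> grading_flag \<pi> e)"
  have sp: "F m = span ?U" 
    using fun_cong[OF eq, of m] unfolding initial_filtration_def by (rule sym)
  have "\<pi> d ` span ?U = span (\<pi> d ` ?U)"
    by (rule endo.linear_span_image[OF grading_linear, symmetric])
  also have "\<dots> \<subseteq> span ?U"
  proof (intro span_minimal subspace_span image_subsetI)
    fix y assume y: "y \<in> ?U"
    then obtain e z where "y = \<pi> e z" by blast
    then have "\<pi> d y = y \<or> \<pi> d y = 0" by (simp add: grading_proj)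
    then show "\<pi> d y \<in> span ?U" using y span_base span_zero by metis
  qed
  finally have "\<pi> d ` F m \<subseteq> F m" using sp by (simp only:)
  then show ?thesis using x by blast
qed

end

section \<open>The weight decomposition of a torus action\<close>

lemma sum_basis_eq: "(\<Sum>b\<in>Basis. scale (representation Basis a b) b) = a"
  by (rule sum_representation_eq[OF independent_Basis _ finite_Basis]) (simp_all add: span_Basis)

lemma bc_outside_Basis: "c \<notin> Basis \<Longrightarrow> bc a c = 0"
  using representation_ne_zero[of Basis a c] unfolding bc_def by auto

lemma bc_in_bc_space: "bc a \<in> bc_space"
  unfolding bc_space_def by (simp add: bc_outside_Basis)

lemma bc_sum: "bc (\<Sum>i\<in>I. f i) c = (\<Sum>i\<in>I. bc (f i) c)"
  unfolding bc_def by (subst representation_sum[OF independent_Basis]) (simp_all add: span_Basis to_ac_sum)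

lemma bc_scale: "bc (scale k a) c = to_ac k * bc a c"
  unfolding bc_def by (subst representation_scale[OF independent_Basis]) (simp_all add: span_Basis)

lemma bc_Basis: "b \<in> Basis \<Longrightarrow> bc b c = (if c = b then 1 else 0)"
  unfolding bc_def by (simp add: representation_basis[OF independent_Basis])

lemma bc_zero: "bc 0 c = 0"
  unfolding bc_def by (simp add: representation_zero)

lemma bc_inject: "bc a = bc a' \<Longrightarrow> a = a'"
proof -
  assume "bc a = bc a'"
  then have "to_ac (representation Basis a b) = to_ac (representation Basis a' b)" for b
    unfolding bc_def by (rule fun_cong)
  then have "(\<Sum>b\<in>Basis. scale (representation Basis a b) b) = (\<Sum>b\<in>Basis. scale (representation Basis a' b) b)"
    by simp
  then show ?thesis unfolding sum_basis_eq .
qed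

lemma bc_expand: "bc a = (\<lambda>c. \<Sum>b\<in>Basis. bc a b * bc b c)"
proof
  fix c
  have "bc a c = bc (\<Sum>b\<in>Basis. scale (representation Basis a b) b) c" by (simp only: sum_basis_eq)
  also have "\<dots> = (\<Sum>b\<in>Basis. to_ac (representation Basis a b) * bc b c)"
    by (simp only: bc_sum bc_scale)
  finally show "bc a c = (\<Sum>b\<in>Basis. bc a b * bc b c)" by (simp only: bc_def)
qed

lemma bc_mult_bc: "bc_mult (bc a) (bc a') = bc (\<mu> a a')"
proof
  fix c
  have "\<mu> a a' = \<mu> (\<Sum>b\<in>Basis. scale (representation Basis a b) b) a'" by (simp only: sum_basis_eq)
  also have "\<dots> = (\<Sum>b\<in>Basis. scale (representation Basis a b) (\<mu> b a'))"
    by (simp add: endo.linear_sum[OF linear_left] endo.linear_scale[OF linear_left])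
  also have "\<dots> = (\<Sum>b\<in>Basis. scale (representation Basis a b)
      (\<mu> b (\<Sum>b'\<in>Basis. scale (representation Basis a' b') b')))" by (simp only: sum_basis_eq)
  also have "\<dots> = (\<Sum>b\<in>Basis. scale (representation Basis a b)
      (\<Sum>b'\<in>Basis. scale (representation Basis a' b') (\<mu> b b')))"
    by (simp add: endo.linear_sum[OF linear_right] endo.linear_scale[OF linear_right])
  finally have "bc (\<mu> a a') c = (\<Sum>b\<in>Basis. to_ac (representation Basis a b) *
      (\<Sum>b'\<in>Basis. to_ac (representation Basis a' b') * bc (\<mu> b b') c))"
    by (simp only: bc_sum bc_scale)
  then show "bc_mult (bc a) (bc a') c = bc (\<mu> a a') c"
    unfolding bc_mult_def by (simp add: sum_distrib_left mult.assoc bc_def)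
qed

lemma
  assumes "bc_automorphism g"
  shows bc_automorphism_bij: "bij_betw g bc_space bc_space"
    and bc_automorphism_add: "v \<in> bc_space \<Longrightarrow> w \<in> bc_space \<Longrightarrow>
      g (\<lambda>b. v b + w b) = (\<lambda>b. g v b + g w b)"
    and bc_automorphism_scale: "v \<in> bc_space \<Longrightarrow> g (\<lambda>b. x * v b) = (\<lambda>b. x * g v b)"
    and bc_automorphism_mult: "v \<in> bc_space \<Longrightarrow> w \<in> bc_space \<Longrightarrow>
      g (bc_mult v w) = bc_mult (g v) (g w)"
  using assms unfolding bc_automorphism_def by simp_all

lemma bc_automorphism_sum:
  assumes g: "bc_automorphism g" and "finite I" and w: "\<And>i. i \<in> I \<Longrightarrow> w i \<in> bc_space"
  shows "g (\<lambda>c. \<Sum>i\<in>I. x i * w i c) = (\<lambda>c. \<Sum>i\<in>I. x i * g (w i) c)"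
  using assms(2) w
proof (induction I rule: finite_induct)
  case empty
  have "(\<lambda>c. 0) \<in> bc_space" unfolding bc_space_def by simp
  from bc_automorphism_scale[OF g this, of 0] show ?case by simp
next
  case (insert j I)
  have 1: "(\<lambda>c. x j * w j c) \<in> bc_space" and 2: "(\<lambda>c. \<Sum>i\<in>I. x i * w i c) \<in> bc_space"
    using insert.prems unfolding bc_space_def by (auto intro!: sum.neutral)
  have "g (\<lambda>c. x j * w j c + (\<Sum>i\<in>I. x i * w i c)) =
      (\<lambda>c. g (\<lambda>c. x j * w j c) c + g (\<lambda>c. \<Sum>i\<in>I. x i * w i c) c)"
    by (rule bc_automorphism_add[OF g 1 2])
  moreover have "g (\<lambda>c. x j * w j c) = (\<lambda>c. x j * g (w j) c)"
    by (rule bc_automorphism_scale[OF g]) (simp add: insert.prems)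
  ultimately show ?case
    using insert.hyps insert.IH insert.prems by simp
qed

context
  fixes r :: nat
    and \<rho> :: "(nat \<Rightarrow> 'k alg_closure) \<Rightarrow> ('a \<Rightarrow> 'k alg_closure) \<Rightarrow> 'a \<Rightarrow> 'k alg_closure"
  assumes action: "torus_action r \<rho>"
begin

lemma action_automorphism: "t \<in> torus r \<Longrightarrow> bc_automorphism (\<rho> t)"
  and action_mult: "s \<in> torus r \<Longrightarrow> t \<in> torus r \<Longrightarrow> v \<in> bc_space \<Longrightarrow>
      \<rho> (torus_mult s t) v = \<rho> s (\<rho> t v)"
  and action_regular: "b \<in> Basis \<Longrightarrow> c \<in> Basis \<Longrightarrow> regular_on_torus r (\<lambda>t. \<rho> t (bc b) c)"
  using action unfolding torus_action_def by simp_all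

lemma action_in_bc_space: "t \<in> torus r \<Longrightarrow> v \<in> bc_space \<Longrightarrow> \<rho> t v \<in> bc_space"
  using bij_betw_apply[OF bc_automorphism_bij[OF action_automorphism]] by blast

text \<open>The unit acts by an idempotent bijection.\<close>

lemma action_one:
  assumes v: "v \<in> bc_space"
  shows "\<rho> (\<lambda>i. 1) v = v"
proof -
  have one: "torus_mult (\<lambda>i. 1) (\<lambda>i. 1) = (\<lambda>i. 1 :: 'k alg_closure)" by (simp add: torus_mult_def)
  have "\<rho> (\<lambda>i. 1) (\<rho> (\<lambda>i. 1) v) = \<rho> (\<lambda>i. 1) v"
    using action_mult[OF one_in_torus one_in_torus v] unfolding one by simp
  moreover have "inj_on (\<rho> (\<lambda>i. 1)) bc_space"
    by (rule bij_betw_imp_inj_on[OF bc_automorphism_bij[OF action_automorphism[OF one_in_torus]]])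
  ultimately show ?thesis
    using action_in_bc_space[OF one_in_torus v] v by (auto dest: inj_onD)
qed

lemma action_on_component_sum:
  assumes "t \<in> torus r" "finite I"
  shows "\<rho> t (\<lambda>c. \<Sum>i\<in>I. x i * bc (a i) c) = (\<lambda>c. \<Sum>i\<in>I. x i * \<rho> t (bc (a i)) c)"
  using bc_automorphism_sum[OF action_automorphism[OF assms(1)] assms(2)] bc_in_bc_space by simp

text \<open>\<open>P n\<close> is the matrix of the coefficients at the monomial \<open>n\<close> of the entries of the action. These
  coefficients lie in \<open>k\<close>, so \<open>P n\<close> is an endomorphism of \<open>A\<close> before base change.\<close>

lemma ex_monomial_expansion:
  "\<exists>N P. finite N \<and> N \<subseteq> exponents r \<and> (\<forall>n. Vector_Spaces.linear scale scale (P n)) \<and>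
     (\<forall>t\<in>torus r. \<forall>a. \<rho> t (bc a) = (\<lambda>c. \<Sum>n\<in>N. monomial r n t * bc (P n a) c))"
proof -
  define R where "R b c N q \<longleftrightarrow> finite N \<and> N \<subseteq> exponents r \<and>
      (\<forall>t\<in>torus r. \<rho> t (bc b) c = (\<Sum>n\<in>N. to_ac (q n) * monomial r n t))" for b c N q
  have "\<exists>N q. R b c N q" if "b \<in> Basis" "c \<in> Basis" for b c
    unfolding R_def by (rule regular_on_torus_exponents[OF action_regular[OF that]])
  then obtain N q where R: "\<And>b c. b \<in> Basis \<Longrightarrow> c \<in> Basis \<Longrightarrow> R b c (N b c) (q b c)"
    by metis
  have N: "finite (N b c)" "N b c \<subseteq> exponents r" if "b \<in> Basis" "c \<in> Basis" for b c
    using R[OF that] by (simp_all add: R_def)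
  have q: "\<rho> t (bc b) c = (\<Sum>n\<in>N b c. to_ac (q b c n) * monomial r n t)"
    if "b \<in> Basis" "c \<in> Basis" "t \<in> torus r" for b c t
    using R[OF that(1,2)] that(3) by (simp add: R_def)
  define M where "M = (\<Union>b\<in>Basis. \<Union>c\<in>Basis. N b c)"
  have M: "finite M" "M \<subseteq> exponents r"
    unfolding M_def by (intro finite_UN_I finite_Basis N(1)) (use N(2) in blast)+
  define q' where "q' b c n = (if n \<in> N b c then q b c n else 0)" for b c n
  have q': "\<rho> t (bc b) c = (\<Sum>n\<in>M. to_ac (q' b c n) * monomial r n t)"
    if "b \<in> Basis" "c \<in> Basis" "t \<in> torus r" for b c t
  proof -
    have "(\<Sum>n\<in>N b c. to_ac (q b c n) * monomial r n t) = (\<Sum>n\<in>M. to_ac (q' b c n) * monomial r n t)"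
      by (rule sum.mono_neutral_cong_left[OF M(1)]) (use that in \<open>auto simp: M_def q'_def\<close>)
    then show ?thesis using q[OF that] by simp
  qed
  define P where "P n a = (\<Sum>b\<in>Basis. \<Sum>c\<in>Basis. scale (representation Basis a b * q' b c n) c)" for n a
  have lin: "Vector_Spaces.linear scale scale (P n)" for n
    unfolding Vector_Spaces.linear_iff P_def
    by (simp add: vector_space_axioms representation_add[OF independent_Basis] span_Basis
        representation_scale[OF independent_Basis] scale_left_distrib distrib_right sum.distrib
        scale_sum_right mult.assoc)
  have bcP: "bc (P n a) c = (\<Sum>b\<in>Basis. bc a b * to_ac (q' b c n))" if c: "c \<in> Basis" for n a c
  proof -
    have "bc (P n a) c = (\<Sum>b\<in>Basis. \<Sum>c'\<in>Basis.
        if c' = c then to_ac (representation Basis a b * q' b c' n) else 0)"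
      unfolding P_def bc_sum bc_scale by (intro sum.cong refl) (auto simp: bc_Basis)
    then show ?thesis using c finite_Basis by (simp add: bc_def)
  qed
  have "\<rho> t (bc a) c = (\<Sum>n\<in>M. monomial r n t * bc (P n a) c)" if t: "t \<in> torus r" for t a c
  proof (cases "c \<in> Basis")
    case False
    then show ?thesis
      using action_in_bc_space[OF t bc_in_bc_space, of a] by (simp add: bc_outside_Basis bc_space_def)
  next
    case True
    have "\<rho> t (bc a) c = \<rho> t (\<lambda>c. \<Sum>b\<in>Basis. bc a b * bc b c) c" by (simp only: bc_expand[symmetric])
    also have "\<dots> = (\<Sum>b\<in>Basis. bc a b * \<rho> t (bc b) c)"
      by (simp only: action_on_component_sum[OF t finite_Basis])
    also have "\<dots> = (\<Sum>b\<in>Basis. \<Sum>n\<in>M. monomial r n t * (bc a b * to_ac (q' b c n)))"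
      by (intro sum.cong refl) (simp add: q'[OF _ True t] sum_distrib_left mult_ac)
    also have "\<dots> = (\<Sum>n\<in>M. monomial r n t * bc (P n a) c)"
      unfolding bcP[OF True] sum_distrib_left by (rule sum.swap)
    finally show ?thesis .
  qed
  then show ?thesis using M lin by (intro exI[of _ M] exI[of _ P]) auto
qed

lemma weight_spaceD:
  "a \<in> weight_space r \<rho> \<chi> \<Longrightarrow> t \<in> torus r \<Longrightarrow> \<rho> t (bc a) = (\<lambda>c. \<chi> t * bc a c)"
  unfolding weight_space_def by blast

lemma weight_space_cong:
  "(\<And>t. t \<in> torus r \<Longrightarrow> \<chi> t = \<chi>' t) \<Longrightarrow> weight_space r \<rho> \<chi> = weight_space r \<rho> \<chi>'"
  unfolding weight_space_def by simp

lemma mult_weight_space: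
  assumes a: "a \<in> weight_space r \<rho> \<chi>" and a': "a' \<in> weight_space r \<rho> \<chi>'"
  shows "\<mu> a a' \<in> weight_space r \<rho> (\<lambda>t. \<chi> t * \<chi>' t)"
  unfolding weight_space_def
proof (intro CollectI ballI)
  fix t :: "nat \<Rightarrow> 'k alg_closure" assume t: "t \<in> torus r"
  have "\<rho> t (bc (\<mu> a a')) = bc_mult (\<rho> t (bc a)) (\<rho> t (bc a'))"
    unfolding bc_mult_bc[symmetric]
    by (rule bc_automorphism_mult[OF action_automorphism[OF t] bc_in_bc_space bc_in_bc_space])
  also have "\<dots> = (\<lambda>c. \<chi> t * \<chi>' t * bc_mult (bc a) (bc a') c)"
    unfolding weight_spaceD[OF a t] weight_spaceD[OF a' t] bc_mult_def
    by (simp add: sum_distrib_left mult_ac)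
  finally show "\<rho> t (bc (\<mu> a a')) = (\<lambda>c. \<chi> t * \<chi>' t * bc (\<mu> a a') c)"
    unfolding bc_mult_bc .
qed

context
  fixes N :: "(nat \<Rightarrow> int) set" and P :: "(nat \<Rightarrow> int) \<Rightarrow> 'a \<Rightarrow> 'a"
  assumes finite_N: "finite N" and N_exponents: "N \<subseteq> exponents r"
    and linear_P: "\<And>n. Vector_Spaces.linear scale scale (P n)"
    and expansion: "\<And>t a. t \<in> torus r \<Longrightarrow>
      \<rho> t (bc a) = (\<lambda>c. \<Sum>n\<in>N. monomial r n t * bc (P n a) c)"
begin

text \<open>Expand \<open>\<rho> (s t) = \<rho> s \<circ> \<rho> t\<close> into monomials in \<open>t\<close>, for fixed \<open>s\<close>, and compare coefficients.\<close>

lemma component_in_weight_space: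
  assumes n: "n \<in> N"
  shows "P n a \<in> weight_space r \<rho> (monomial r n)"
  unfolding weight_space_def
proof (intro CollectI ballI ext)
  fix s :: "nat \<Rightarrow> 'k alg_closure" and c assume s: "s \<in> torus r"
  show "\<rho> s (bc (P n a)) c = monomial r n s * bc (P n a) c"
  proof (rule monomials_independent_eq[OF finite_N N_exponents _ n,
        of "\<lambda>n. \<rho> s (bc (P n a)) c" "\<lambda>n. monomial r n s * bc (P n a) c"])
    fix t :: "nat \<Rightarrow> 'k alg_closure" assume t: "t \<in> torus r"
    have "(\<Sum>n\<in>N. monomial r n t * \<rho> s (bc (P n a)) c) = \<rho> s (\<rho> t (bc a)) c"
      by (simp only: expansion[OF t, of a] action_on_component_sum[OF s finite_N])
    also have "\<dots> = \<rho> (torus_mult s t) (bc a) c"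
      by (simp only: action_mult[OF s t bc_in_bc_space])
    also have "\<dots> = (\<Sum>n\<in>N. monomial r n t * (monomial r n s * bc (P n a) c))"
      by (simp add: expansion[OF torus_mult_in_torus[OF s t]] monomial_torus_mult mult_ac)
    finally show "(\<Sum>n\<in>N. monomial r n t * \<rho> s (bc (P n a)) c) =
        (\<Sum>n\<in>N. monomial r n t * (monomial r n s * bc (P n a) c))" .
  qed
qed

lemma sum_components: "(\<Sum>n\<in>N. P n a) = a"
proof (rule bc_inject, rule ext)
  fix c
  have "bc a c = \<rho> (\<lambda>i. 1) (bc a) c" by (simp only: action_one[OF bc_in_bc_space])
  also have "\<dots> = (\<Sum>n\<in>N. bc (P n a) c)" by (simp add: expansion[OF one_in_torus] monomial_one)
  finally show "bc (\<Sum>n\<in>N. P n a) c = bc a c" by (simp only: bc_sum)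
qed

text \<open>For a weight vector \<open>a\<close>, expanding \<open>\<rho> (s t) a = \<chi> s * \<rho> t a\<close> into monomials in \<open>t\<close> shows that
  \<open>P n a\<close> is a weight vector both for \<open>\<chi>\<close> and for the monomial \<open>n\<close>.\<close>

lemma component_of_weight_vector:
  assumes a: "a \<in> weight_space r \<rho> \<chi>"
    and \<chi>: "\<And>s t. s \<in> torus r \<Longrightarrow> t \<in> torus r \<Longrightarrow> \<chi> (torus_mult s t) = \<chi> s * \<chi> t"
    and n: "n \<in> N" and nz: "P n a \<noteq> 0" and s: "s \<in> torus r"
  shows "\<chi> s = monomial r n s"
proof -
  have "bc (P n a) \<noteq> bc 0" using nz bc_inject by blast
  then obtain c where c: "bc (P n a) c \<noteq> 0" using bc_zero by fastforce
  have "\<chi> s * bc (P n a) c = monomial r n s * bc (P n a) c"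
  proof (rule monomials_independent_eq[OF finite_N N_exponents _ n,
        of "\<lambda>n. \<chi> s * bc (P n a) c" "\<lambda>n. monomial r n s * bc (P n a) c"])
    fix t :: "nat \<Rightarrow> 'k alg_closure" assume t: "t \<in> torus r"
    have "(\<Sum>n\<in>N. monomial r n t * (\<chi> s * bc (P n a) c)) = \<chi> s * \<rho> t (bc a) c"
      by (simp add: expansion[OF t] sum_distrib_left mult_ac)
    also have "\<dots> = \<rho> (torus_mult s t) (bc a) c"
      by (simp add: weight_spaceD[OF a] t s torus_mult_in_torus \<chi>)
    also have "\<dots> = (\<Sum>n\<in>N. monomial r n t * (monomial r n s * bc (P n a) c))"
      by (simp add: expansion[OF torus_mult_in_torus[OF s t]] monomial_torus_mult mult_ac)
    finally show "(\<Sum>n\<in>N. monomial r n t * (\<chi> s * bc (P n a) c)) =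
        (\<Sum>n\<in>N. monomial r n t * (monomial r n s * bc (P n a) c))" .
  qed
  then show ?thesis using c by simp
qed

lemma component_of_monomial_weight_vector:
  assumes a: "a \<in> weight_space r \<rho> (monomial r n')" and n': "n' \<in> exponents r"
    and n: "n \<in> N" and ne: "n \<noteq> n'"
  shows "P n a = 0"
proof (rule ccontr)
  assume "P n a \<noteq> 0"
  then have "monomial r n' s = monomial r n s" if "s \<in> torus r" for s :: "nat \<Rightarrow> 'k alg_closure"
    using component_of_weight_vector[OF a _ n _ that] monomial_torus_mult by blast
  then have "n' = n" using monomial_inject[OF n', of n] n N_exponents by blast
  then show False using ne by simp
qed

lemma component_component:
  assumes "n \<in> N" "n' \<in> N"
  shows "P n (P n' a) = (if n = n' then P n' a else 0)"
proof -
  have other: "P k (P n' a) = 0" if "k \<in> N" "k \<noteq> n'" for k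
    using component_of_monomial_weight_vector[OF component_in_weight_space] assms that N_exponents by blast
  have "P n' a = (\<Sum>k\<in>N. P k (P n' a))" by (simp only: sum_components)
  also have "\<dots> = (\<Sum>k\<in>N. if k = n' then P n' (P n' a) else 0)"
    by (intro sum.cong refl) (auto simp: other)
  also have "\<dots> = P n' (P n' a)" using assms(2) finite_N by (simp add: sum.delta)
  finally show ?thesis using other assms(1) by auto
qed

text \<open>A separating one-parameter subgroup gives the weight spaces that occur distinct integer degrees, so each \<open>P n\<close> is
  a projection of an integer grading.\<close>

theorem canonical_filtration_component:
  assumes F: "canonical_filtration F" and x: "x \<in> F m" and n: "n \<in> N"
  shows "P n x \<in> F m"
proof -
  obtain l :: "nat \<Rightarrow> int" where "inj_on (\<lambda>n. \<Sum>i<r. l i * n i) N"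
    using separating_cocharacter[OF finite_N N_exponents] .
  then obtain d where d: "d = (\<lambda>n. \<Sum>i<r. l i * n i)" and inj: "inj_on d N" by blast
  define \<pi> where "\<pi> e a = (\<Sum>n\<in>{n \<in> N. d n = e}. P n a)" for e a
  have \<pi>_d: "\<pi> (d n) = P n" if "n \<in> N" for n
  proof -
    have "{k \<in> N. d k = d n} = {n}" using that inj by (auto dest: inj_onD)
    then show ?thesis unfolding \<pi>_def by (intro ext) simp
  qed
  have \<pi>_out: "\<pi> e a = 0" if "e \<notin> d ` N" for e a
    unfolding \<pi>_def using that by (intro sum.neutral) auto
  have "grading (d ` N) \<pi>"
    unfolding grading_def
  proof (intro conjI allI)
    show "finite (d ` N)" using finite_N by simp
    show lin: "Vector_Spaces.linear scale scale (\<pi> e)" for e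
      unfolding \<pi>_def by (rule endo.linear_compose_sum) (simp add: linear_P)
    show "\<pi> e (\<pi> e' a) = (if e = e' then \<pi> e' a else 0)" for e e' a
    proof (cases "e \<in> d ` N \<and> e' \<in> d ` N")
      case True
      then obtain k k' where "k \<in> N" "k' \<in> N" "e = d k" "e' = d k'" by blast
      then show ?thesis
        using component_component[of k k' a] inj_on_eq_iff[OF inj] by (simp add: \<pi>_d)
    next
      case False
      then show ?thesis using \<pi>_out endo.linear_0[OF lin] by auto
    qed
    show "(\<Sum>e\<in>d ` N. \<pi> e a) = a" for a
      by (simp add: sum.reindex[OF inj] \<pi>_d sum_components)
    show "\<pi> (e + e') (\<mu> (\<pi> e a) (\<pi> e' a')) = \<mu> (\<pi> e a) (\<pi> e' a')" for e e' a a'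
    proof (cases "e \<in> d ` N \<and> e' \<in> d ` N")
      case True
      then obtain k k' where k: "k \<in> N" "k' \<in> N" and e: "e = d k" "e' = d k'" by blast
      let ?z = "\<mu> (P k a) (P k' a')" and ?n = "\<lambda>i. k i + k' i"
      have "?z \<in> weight_space r \<rho> (\<lambda>t. monomial r k t * monomial r k' t)"
        by (intro mult_weight_space component_in_weight_space k)
      then have z: "?z \<in> weight_space r \<rho> (monomial r ?n)"
        by (subst weight_space_cong[OF monomial_add])
      have "k \<in> exponents r" "k' \<in> exponents r" using k N_exponents by blast+
      then have n: "?n \<in> exponents r" unfolding exponents_def by simp
      \<comment> \<open>The exponent \<open>?n\<close> may lie outside \<open>N\<close>; then all components of \<open>?z\<close> vanish.\<close>
      have dn: "d ?n = e + e'" unfolding d e by (simp add: distrib_left sum.distrib)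
      have "\<pi> (e + e') ?z = (\<Sum>n\<in>N. P n ?z)"
        unfolding \<pi>_def
      proof (rule sum.mono_neutral_left[OF finite_N])
        show "\<forall>i\<in>N - {n \<in> N. d n = e + e'}. P i ?z = 0"
          using component_of_monomial_weight_vector[OF z n] dn by blast
      qed blast
      then show ?thesis using k by (simp add: sum_components \<pi>_d e)
    next
      case False
      then have "\<mu> (\<pi> e a) (\<pi> e' a') = 0"
        using \<pi>_out endo.linear_0[OF linear_left] endo.linear_0[OF linear_right] by auto
      then show ?thesis by (simp add: endo.linear_0[OF lin])
    qed
  qed
  then have "\<pi> (d n) x \<in> F m" by (rule canonical_filtration_graded[OF _ F x])
  then show ?thesis using n by (simp add: \<pi>_d)
qed

lemma inj_monomial_character:
  "inj_on (monomial_character r :: _ \<Rightarrow> (nat \<Rightarrow> 'k alg_closure) \<Rightarrow> 'k alg_closure) N"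
  by (rule inj_on_subset[OF inj_on_monomial_character N_exponents])

text \<open>A character with a nonzero weight vector is the monomial of some \<open>n \<in> N\<close>, so the \<open>P n\<close> are the projections
  for the decomposition indexed by all characters.\<close>

lemma weight_vector_eq_component:
  assumes a: "a \<in> weight_space r \<rho> \<chi>" and \<chi>: "\<chi> \<in> characters r"
  shows "n \<in> N \<Longrightarrow> P n a = (if \<chi> = monomial_character r n then a else 0)"
    and "\<chi> \<notin> monomial_character r ` N \<Longrightarrow> a = 0"
proof -
  have eq: "\<chi> = monomial_character r k" if "k \<in> N" "P k a \<noteq> 0" for k
  proof
    fix t
    have mult: "\<chi> (torus_mult s t) = \<chi> s * \<chi> t" if "s \<in> torus r" "t \<in> torus r" for s t
      using \<chi> that unfolding characters_def by blast
    show "\<chi> t = monomial_character r k t"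
    proof (cases "t \<in> torus r")
      case True
      then have "\<chi> t = monomial r k t"
        by (intro component_of_weight_vector[OF a _ that] mult)
      then show ?thesis using True by (simp add: monomial_character_def)
    next
      case False
      then show ?thesis using \<chi> unfolding characters_def monomial_character_def by simp
    qed
  qed
  show "P n a = (if \<chi> = monomial_character r n then a else 0)" if n: "n \<in> N"
  proof (cases "\<chi> = monomial_character r n")
    case True
    have "P k a = 0" if "k \<in> N" "k \<noteq> n" for k
      using eq[OF that(1)] inj_onD[OF inj_monomial_character _ that(1) n] True that(2) by auto
    then have "(\<Sum>k\<in>N. P k a) = (\<Sum>k\<in>N. if k = n then P n a else 0)" by (intro sum.cong) auto
    then show ?thesis using True n finite_N by (simp add: sum_components)
  next
    case False
    then show ?thesis using eq[OF n] by auto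
  qed
  show "a = 0" if "\<chi> \<notin> monomial_character r ` N"
  proof -
    have "(\<Sum>k\<in>N. P k a) = 0" using eq that by (intro sum.neutral) blast
    then show ?thesis by (simp only: sum_components)
  qed
qed

text \<open>A family of weight vectors is recovered from its sum by applying the \<open>P n\<close>, and a vector of \<open>W\<close> is the sum of its
  images under the \<open>P n\<close>, which stay in \<open>W\<close>.\<close>

lemma internal_direct_sum_weight_spaces:
  assumes W: "subspace W" and stable: "\<And>n x. n \<in> N \<Longrightarrow> x \<in> W \<Longrightarrow> P n x \<in> W"
  shows "internal_direct_sum (characters r) (\<lambda>\<chi>. weight_space r \<rho> \<chi> \<inter> W) W"
proof -
  let ?c = "monomial_character r :: _ \<Rightarrow> (nat \<Rightarrow> 'k alg_closure) \<Rightarrow> 'k alg_closure"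
  define A where "A = {f. (\<forall>\<chi>\<in>characters r. f \<chi> \<in> weight_space r \<rho> \<chi> \<inter> W) \<and>
      (\<forall>\<chi>. \<chi> \<notin> characters r \<longrightarrow> f \<chi> = 0) \<and> finite {\<chi>. f \<chi> \<noteq> 0}}"
  note inj_c = inj_monomial_character
  have supp: "{\<chi>. f \<chi> \<noteq> 0} \<subseteq> ?c ` N" if f: "f \<in> A" for f
  proof (rule subsetI, rule ccontr)
    fix \<chi> assume nz: "\<chi> \<in> {\<chi>. f \<chi> \<noteq> 0}" and out: "\<chi> \<notin> ?c ` N"
    have "\<chi> \<in> characters r" using f nz unfolding A_def by blast
    then have "f \<chi> = 0"
      using weight_vector_eq_component(2)[OF _ _ out] f unfolding A_def by blast
    then show False using nz by simp
  qed
  have total: "(\<Sum>\<chi> | f \<chi> \<noteq> 0. f \<chi>) = (\<Sum>n\<in>N. f (?c n))" if f: "f \<in> A" for f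
  proof -
    have "(\<Sum>\<chi> | f \<chi> \<noteq> 0. f \<chi>) = (\<Sum>\<chi>\<in>?c ` N. f \<chi>)"
      using supp[OF f] finite_N by (intro sum.mono_neutral_left) auto
    then show ?thesis by (simp add: sum.reindex[OF inj_c])
  qed
  have comp: "P n (\<Sum>\<chi> | f \<chi> \<noteq> 0. f \<chi>) = f (?c n)" if f: "f \<in> A" and n: "n \<in> N" for f n
  proof -
    have "P n (f (?c k)) = (if k = n then f (?c n) else 0)" if k: "k \<in> N" for k
    proof -
      have "f (?c k) \<in> weight_space r \<rho> (?c k)"
        using f monomial_character_in_characters unfolding A_def by blast
      then show ?thesis
        using weight_vector_eq_component(1)[OF _ monomial_character_in_characters n] inj_on_eq_iff[OF inj_c k n]
        by simp
    qed
    then show ?thesis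
      unfolding total[OF f] endo.linear_sum[OF linear_P] using n finite_N by simp
  qed
  have "bij_betw (\<lambda>f. \<Sum>\<chi> | f \<chi> \<noteq> 0. f \<chi>) A W"
    unfolding bij_betw_def
  proof (intro conjI equalityI subsetI)
    show "inj_on (\<lambda>f. \<Sum>\<chi> | f \<chi> \<noteq> 0. f \<chi>) A"
    proof (rule inj_onI)
      fix f g
      assume f: "f \<in> A" and g: "g \<in> A" and eq: "(\<Sum>\<chi> | f \<chi> \<noteq> 0. f \<chi>) = (\<Sum>\<chi> | g \<chi> \<noteq> 0. g \<chi>)"
      have "f \<chi> = g \<chi>" for \<chi>
      proof (cases "\<chi> \<in> ?c ` N")
        case True
        then obtain n where "n \<in> N" "\<chi> = ?c n" by blast
        then show ?thesis using comp[OF f] comp[OF g] eq by simp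
      next
        case False
        then have "\<not> f \<chi> \<noteq> 0" "\<not> g \<chi> \<noteq> 0" using supp[OF f] supp[OF g] by blast+
        then show ?thesis by simp
      qed
      then show "f = g" by (rule ext)
    qed
  next
    fix x assume "x \<in> (\<lambda>f. \<Sum>\<chi> | f \<chi> \<noteq> 0. f \<chi>) ` A"
    then obtain f where f: "f \<in> A" and x: "x = (\<Sum>n\<in>N. f (?c n))" using total by auto
    have "f (?c n) \<in> W" for n
      using f monomial_character_in_characters unfolding A_def by blast
    then show "x \<in> W" unfolding x by (intro subspace_sum W)
  next
    fix x assume x: "x \<in> W"
    define f where "f \<chi> = (if \<chi> \<in> ?c ` N then P (inv_into N ?c \<chi>) x else 0)" for \<chi>
    have f_c: "f (?c n) = P n x" if "n \<in> N" for n
      using that inj_c by (simp add: f_def)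
    have "f \<in> A"
      unfolding A_def
    proof (intro CollectI conjI ballI allI impI)
      fix \<chi> :: "(nat \<Rightarrow> 'k alg_closure) \<Rightarrow> 'k alg_closure"
      show "f \<chi> \<in> weight_space r \<rho> \<chi> \<inter> W"
      proof (cases "\<chi> \<in> ?c ` N")
        case True
        then obtain n where n: "n \<in> N" "\<chi> = ?c n" by blast
        have "P n x \<in> weight_space r \<rho> (?c n)"
          using component_in_weight_space[OF n(1)] weight_space_cong[of "?c n" "monomial r n"]
          by (simp add: monomial_character_def)
        then show ?thesis using stable[OF n(1) x] n f_c by simp
      next
        case False
        then have "f \<chi> = 0" by (simp add: f_def)
        moreover have "0 \<in> weight_space r \<rho> \<chi>"
          unfolding weight_space_def
        proof (intro CollectI ballI)
          fix t :: "nat \<Rightarrow> 'k alg_closure" assume t: "t \<in> torus r"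
          show "\<rho> t (bc 0) = (\<lambda>b. \<chi> t * bc 0 b)"
            using action_on_component_sum[OF t, of "{}" "\<lambda>_. 0" "\<lambda>_. 0"] by (simp add: bc_zero[abs_def])
        qed
        ultimately show ?thesis using subspace_0[OF W] by simp
      qed
    next
      fix \<chi> :: "(nat \<Rightarrow> 'k alg_closure) \<Rightarrow> 'k alg_closure"
      assume "\<chi> \<notin> characters r"
      then show "f \<chi> = 0" using monomial_character_in_characters by (auto simp: f_def)
    next
      show "finite {\<chi>. f \<chi> \<noteq> 0}"
        by (rule finite_subset[of _ "?c ` N"]) (use finite_N in \<open>auto simp: f_def\<close>)
    qed
    moreover from this have "(\<Sum>\<chi> | f \<chi> \<noteq> 0. f \<chi>) = x"
      by (simp add: total f_c sum_components)
    ultimately show "x \<in> (\<lambda>f. \<Sum>\<chi> | f \<chi> \<noteq> 0. f \<chi>) ` A" by (intro image_eqI[of _ _ f]) simp_all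
  qed
  then show ?thesis unfolding internal_direct_sum_def A_def .
qed

end

theorem canonical_filtration_internal_direct_sum:
  assumes F: "canonical_filtration F"
  shows "internal_direct_sum (characters r) (\<lambda>\<chi>. weight_space r \<rho> \<chi> \<inter> F m) (F m)"
proof -
  obtain N P where N: "finite N" "N \<subseteq> exponents r"
    and P: "\<forall>n. Vector_Spaces.linear scale scale (P n)"
    and expansion: "\<forall>t\<in>torus r. \<forall>a. \<rho> t (bc a) = (\<lambda>c. \<Sum>n\<in>N. monomial r n t * bc (P n a) c)"
    using ex_monomial_expansion by (elim exE conjE)
  note NP = N P[rule_format] expansion[rule_format]
  show ?thesis
  proof (rule internal_direct_sum_weight_spaces[OF NP])
    show "subspace (F m)"
    proof (cases semistable)
      case True
      then show ?thesis
        using F subspace_UNIV subspace_single_0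
        unfolding canonical_filtration_def trivial_filtration_def by simp
    next
      case False
      then have "flag F" using F filtration_flag unfolding canonical_filtration_def by simp
      then show ?thesis by (rule flag_subspace)
    qed
    show "P n x \<in> F m" if "n \<in> N" "x \<in> F m" for n x
      by (rule canonical_filtration_component[OF NP F that(2,1)])
  qed
qed

end

end

theorem corollary3p5:
  fixes scale :: "'k::field \<Rightarrow> 'a::ab_group_add \<Rightarrow> 'a"
    and Basis :: "'a set"
    and \<mu> :: "'a \<Rightarrow> 'a \<Rightarrow> 'a"
    and r :: nat
    and \<rho> :: "(nat \<Rightarrow> 'k alg_closure) \<Rightarrow> ('a \<Rightarrow> 'k alg_closure) \<Rightarrow> 'a \<Rightarrow> 'k alg_closure"
    and F :: "int \<Rightarrow> 'a set"
    and m :: int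
  assumes "perfect_field TYPE('k)"
    and "fd_algebra scale Basis \<mu>"
    and "fd_algebra.torus_action scale Basis \<mu> r \<rho>"
    and "fd_algebra.canonical_filtration scale \<mu> F"
  shows "internal_direct_sum (characters r)
           (\<lambda>\<chi>. fd_algebra.weight_space scale Basis r \<rho> \<chi> \<inter> F m) (F m)"
  using fd_algebra.canonical_filtration_internal_direct_sum[OF assms(2-4)] .

end
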